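(* Let $E,A\in\mathbb{R}^{n\times n}$ be such that $\lambda E+A$ is non-singular for some $\lambda\in\mathbb{R}$, and let $f:I\to\mathbb{R}^n$ be sufficiently smooth on an open interval $I\subseteq\mathbb{R}$. Apply the deflation algorithm to the DAE $E\dot x=Ax+f$. Then the algorithm stops, and its number of steps is bounded by $\min(\operatorname{rank}(E),\operatorname{ind}(E,A))$, where $\operatorname{ind}(E,A)$ is the Kronecker index of the pencil $(E,A)$. Moreover, the ranks of the matrices $E_j$ and $A_j$ produced by the algorithm form a sequence of invariants of $(E,A)$: they depend only on $E$ and $A$, and not on the choices made at the successive deflation steps.
   Context: Kronecker index. The index $\operatorname{ind}(B)$ of a square matrix $B$ is the smallest integer $k\ge 0$ with $\operatorname{Ker}(B^k)=\operatorname{Ker}(B^{k+1})$ (with $B^0=I$). A pencil $(E,A)$ is regular if $\lambda E+A$ is non-singular for some $\lambda\in\mathbb{R}$; then $\operatorname{ind}(E,A)$ is the index of $(\lambda E+A)^{-1}E$ for such a $\lambda$ (it does not depend on $\lambda$). Deflation step. Let $(E,A)$ be a regular pencil of size $n\times n$ with $\operatorname{rank}E=r$, and $f$ a smooth vector function. Choose an invertible matrix $U$ and a permutation matrix $P$ such that $$U^{-1}EP=\begin{pmatrix} S & T \\ 0 & 0 \end{pmatrix},\qquad U^{-1}AP=\begin{pmatrix} K & L \\ M & N \end{pmatrix},$$ with $S,K\in\mathbb{R}^{r\times r}$, $T,L\in\mathbb{R}^{r\times(n-r)}$, $M\in\mathbb{R}^{(n-r)\times r}$ and $N\in\mathbb{R}^{(n-r)\times(n-r)}$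 non-singular (such choices exist but are not unique). Write $U^{-1}f=(g,h)^T$ with $g$ of size $r$ and $h$ of size $n-r$. A deflated DAE of $E\dot x=Ax+f$ is $E_1\dot x^1=A_1x^1+f_1$ with $$E_1=S-TN^{-1}M,\quad A_1=K-LN^{-1}M,\quad f_1=TN^{-1}\dot h-LN^{-1}h+g .$$ The pencil $(E_1,A_1)$ is again regular. Deflation algorithm. Start with $(E_0,A_0,f_0)=(E,A,f)$. At step $j+1$ ($j\ge 0$): if $E_j$ is singular and $E_j\neq 0$, replace $(E_j,A_j,f_j)$ by a triple $(E_{j+1},A_{j+1},f_{j+1})$ obtained by one deflation step; otherwise stop. The number of steps is the number of deflation steps performed. *)

theory Defs
  imports
    "HOL-Combinatorics.Permutations"
    "Jordan_Normal_Form.Gauss_Jordan_Elimination"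
    "Jordan_Normal_Form.Matrix_Kernel"
    "Jordan_Normal_Form.DL_Rank"
begin

definition mat_rank :: "real mat \<Rightarrow> nat" where
  "mat_rank B = vec_space.rank (dim_row B) B"

text \<open>Only meaningful for invertible matrices; see the lemma below.\<close>

definition minv :: "real mat \<Rightarrow> real mat" where
  "minv B = the (mat_inverse B)"

lemma minv:
  assumes B: "B \<in> carrier_mat n n" and inv: "invertible_mat B"
  shows "minv B \<in> carrier_mat n n" "B * minv B = 1\<^sub>m n" "minv B * B = 1\<^sub>m n"
proof -
  from inv obtain C where BC: "B * C = 1\<^sub>m (dim_row B)" and CB: "C * B = 1\<^sub>m (dim_row C)"
    unfolding invertible_mat_def inverts_mat_def by blast
  have "dim_col C = n" using arg_cong[OF BC, of dim_col] B by simp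
  moreover have "dim_row C = n" using arg_cong[OF CB, of dim_col] B by simp
  ultimately have C: "C \<in> carrier_mat n n" by auto
  have "B \<in> Units (ring_mat TYPE(real) n ())"
    unfolding Units_def ring_mat_def using B C BC CB by auto
  then have "mat_inverse B \<noteq> None"
    using mat_inverse(1)[OF B, of "()"] by blast
  then obtain D where D: "mat_inverse B = Some D" by blast
  from mat_inverse(2)[OF B D] show "minv B \<in> carrier_mat n n" "B * minv B = 1\<^sub>m n" "minv B * B = 1\<^sub>m n"
    by (auto simp: minv_def D)
qed

definition mat_index :: "real mat \<Rightarrow> nat" where
  "mat_index B = (LEAST k. mat_kernel (B ^\<^sub>m k) = mat_kernel (B ^\<^sub>m (Suc k)))"

definition regular_pencil :: "nat \<Rightarrow> real mat \<Rightarrow> real mat \<Rightarrow> bool" where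
  "regular_pencil n E A \<longleftrightarrow>
     E \<in> carrier_mat n n \<and> A \<in> carrier_mat n n \<and> (\<exists>l. invertible_mat (l \<cdot>\<^sub>m E + A))"

text \<open>The index does not depend on the admissible value \<open>l\<close>, so an arbitrary one is chosen.\<close>

definition kronecker_index :: "real mat \<Rightarrow> real mat \<Rightarrow> nat" where
  "kronecker_index E A =
     (let l = (SOME l. invertible_mat (l \<cdot>\<^sub>m E + A)) in mat_index (minv (l \<cdot>\<^sub>m E + A) * E))"

definition permutation_matrix :: "nat \<Rightarrow> real mat \<Rightarrow> bool" where
  "permutation_matrix n P \<longleftrightarrow>
     (\<exists>p. p permutes {..<n} \<and> P = mat n n (\<lambda>(i, j). if i = p j then 1 else 0))"

text \<open>
  \<open>C_diff_on k I u\<close>: the function \<open>u\<close> is \<open>k\<close> times continuously differentiable on the open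
  set \<open>I\<close>.
\<close>

primrec C_diff_on :: "nat \<Rightarrow> real set \<Rightarrow> (real \<Rightarrow> real) \<Rightarrow> bool" where
  "C_diff_on 0 I u \<longleftrightarrow> continuous_on I u"
| "C_diff_on (Suc k) I u \<longleftrightarrow>
     (\<exists>u'. (\<forall>t\<in>I. (u has_real_derivative u' t) (at t)) \<and> C_diff_on k I u')"

definition vec_C_diff_on :: "nat \<Rightarrow> nat \<Rightarrow> real set \<Rightarrow> (real \<Rightarrow> real vec) \<Rightarrow> bool" where
  "vec_C_diff_on k n I f \<longleftrightarrow>
     (\<forall>t\<in>I. f t \<in> carrier_vec n) \<and> (\<forall>i<n. C_diff_on k I (\<lambda>t. f t $ i))"

definition vec_deriv_on ::
    "nat \<Rightarrow> real set \<Rightarrow> (real \<Rightarrow> real vec) \<Rightarrow> (real \<Rightarrow> real vec) \<Rightarrow> bool" where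
  "vec_deriv_on m I h h' \<longleftrightarrow>
     (\<forall>t\<in>I. h t \<in> carrier_vec m \<and> h' t \<in> carrier_vec m \<and>
        (\<forall>i<m. ((\<lambda>s. h s $ i) has_real_derivative h' t $ i) (at t)))"

text \<open>
  A triple \<open>(E, A, f)\<close> stands for the equation \<open>E x' = A x + f\<close>. Only the values of \<open>f\<close> on
  the interval \<open>I\<close> under consideration matter.
\<close>

type_synonym dae = "real mat \<times> real mat \<times> (real \<Rightarrow> real vec)"

text \<open>
  The step is a relation, since \<open>U\<close> and \<open>P\<close> are not unique. It is possible only if the
  component \<open>h\<close> of the inhomogeneity is differentiable on \<open>I\<close>.
\<close>

definition deflation_step :: "real set \<Rightarrow> dae \<Rightarrow> dae \<Rightarrow> bool" where
  "deflation_step I = (\<lambda>(E, A, f) (E1, A1, f1). let n = dim_row E; r = mat_rank E in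
     regular_pencil n E A \<and>
     (\<exists>U P S T K L M N g h h'.
        U \<in> carrier_mat n n \<and> invertible_mat U \<and> permutation_matrix n P \<and>
        S \<in> carrier_mat r r \<and> K \<in> carrier_mat r r \<and>
        T \<in> carrier_mat r (n - r) \<and> L \<in> carrier_mat r (n - r) \<and>
        M \<in> carrier_mat (n - r) r \<and>
        N \<in> carrier_mat (n - r) (n - r) \<and> invertible_mat N \<and>
        minv U * E * P = four_block_mat S T (0\<^sub>m (n - r) r) (0\<^sub>m (n - r) (n - r)) \<and>
        minv U * A * P = four_block_mat K L M N \<and>
        (\<forall>t\<in>I. g t \<in> carrier_vec r \<and> h t \<in> carrier_vec (n - r) \<and>
               minv U *\<^sub>v f t = g t @\<^sub>v h t) \<and>
        vec_deriv_on (n - r) I h h' \<and>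
        E1 = S - T * minv N * M \<and>
        A1 = K - L * minv N * M \<and>
        (\<forall>t\<in>I. f1 t = (T * minv N) *\<^sub>v h' t - (L * minv N) *\<^sub>v h t + g t)))"

text \<open>The condition under which the deflation algorithm performs a further step.\<close>

fun continues :: "dae \<Rightarrow> bool" where
  "continues (E, A, f) \<longleftrightarrow> \<not> invertible_mat E \<and> E \<noteq> 0\<^sub>m (dim_row E) (dim_col E)"

text \<open>
  \<open>s 0, \<dots>, s k\<close> are the successive triples of an execution of which \<open>k\<close> steps have been
  performed; the values of \<open>s\<close> beyond \<open>k\<close> are irrelevant. The execution has
  stopped after exactly \<open>k\<close> steps if moreover \<open>continues (s k)\<close> fails.
\<close>

definition deflation_run :: "real set \<Rightarrow> dae \<Rightarrow> nat \<Rightarrow> (nat \<Rightarrow> dae) \<Rightarrow> bool" where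
  "deflation_run I D k s \<longleftrightarrow>
     s 0 = D \<and> (\<forall>j<k. continues (s j) \<and> deflation_step I (s j) (s (Suc j)))"

definition E_of :: "dae \<Rightarrow> real mat" where "E_of D = fst D"

definition A_of :: "dae \<Rightarrow> real mat" where "A_of D = fst (snd D)"

end

(*
  A full-rank factorization E = X Y (X left-invertible, Y right-invertible) has inner dimension
  rank E. Fix l with l E + A invertible. Taking Schur complements of the invertible block N in
  the transformed pencil shows that l E1 + A1 is again invertible and that rank A drops by exactly
  n - r in a step. Writing B = (l E + A)^-1 E and B1 = (l E1 + A1)^-1 E1, the transformed blocks
  give factors X, R with B = X R where X is left-invertible, R is right-invertible and R X is similar to B1;
  hence rank (B1^k) = rank (B^(k+1)). Along a run this yields size E_j = rank (B^j) and
  rank E_j = rank (B^(j+1)), independently of all choices. The algorithm continues as long as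
  these ranks strictly decrease to a nonzero value, which happens at most min (rank E) (ind B) times.
*)
theory Submission
  imports Defs
begin

section \<open>Rank and full-rank factorizations\<close>


text \<open>The index shift comes from the swap (X R)^(k+1) = X (R X)^k R: exchanging the factors
  costs exactly one power. One value of l serves a whole run, because the zero block rows of the
  transformed E leave the lower rows (M, N) of the transformed l E + A independent of l. Two
  obstacles shape the proof. The index is defined through kernels, whereas the algorithm sees ranks;
  factoring one matrix through the full-rank factor of another translates between them. And a step
  exists only if a derivative is available, while every step consumes one. Supply and consumption
  are matched by a strict bound: if the algorithm is still to continue after k steps, then k < min
  (rank E) (ind (E, A)), so an f with that many derivatives has at least one left. The bound is
  computed with the value of l selected inside \<open>kronecker_index\<close>; the comparison of two
  runs fixes one admissible l for both.\<close>

lemma invertible_matI: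
  fixes A B :: "real mat"
  assumes A: "A \<in> carrier_mat n n" and B: "B \<in> carrier_mat n n" and AB: "A * B = 1\<^sub>m n"
  shows "invertible_mat A" "minv A = B"
proof -
  have BA: "B * A = 1\<^sub>m n" using mat_mult_left_right_inverse[OF A B AB] .
  show inv: "invertible_mat A"
    unfolding invertible_mat_def inverts_mat_def using A B AB BA by auto
  have "minv A = (B * A) * minv A" using BA minv(1)[OF A inv] by simp
  also have "\<dots> = B" using A B minv(1,2)[OF A inv] by (simp add: assoc_mult_mat[of _ n n _ n _ n])
  finally show "minv A = B" .
qed

text \<open>In reduced row echelon form a row without pivot has its pivot position set to
  \<open>nc\<close>, and positions increase strictly until then. Hence the zero rows come last, and
  \<open>r\<close> counts the rows above them.\<close>

lemma gauss_jordan_pivots: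
  fixes A :: "real mat"
  assumes A: "A \<in> carrier_mat nr nc"
  obtains G H r p where "G \<in> carrier_mat nr nr" "H \<in> carrier_mat nr nr"
    "G * H = 1\<^sub>m nr" "H * G = 1\<^sub>m nr" "r \<le> nr" "\<And>k. k < r \<Longrightarrow> p k < nc"
    "\<And>i k. i < nr \<Longrightarrow> k < r \<Longrightarrow> (G * A) $$ (i, p k) = (if i = k then 1 else 0)"
    "\<And>i j. r \<le> i \<Longrightarrow> i < nr \<Longrightarrow> j < nc \<Longrightarrow> (G * A) $$ (i, j) = 0"
proof -
  define C where "C = gauss_jordan_single A"
  note gj = gauss_jordan_single[OF A C_def[symmetric]]
  obtain G H where GH: "C = G * A" "G \<in> carrier_mat nr nr" "H \<in> carrier_mat nr nr"
    "G * H = 1\<^sub>m nr" "H * G = 1\<^sub>m nr" using gj(4) by blast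
  obtain p where "pivot_fun C p (dim_col C)" using gj(3) unfolding row_echelon_form_def by blast
  then have p: "pivot_fun C p nc" using gj(2) by auto
  have d: "dim_row C = nr" using gj(2) by auto
  note P = pivot_funD[OF d p]
  define r where "r = (LEAST i. i = nr \<or> p i = nc)"
  have r: "r = nr \<or> p r = nc" unfolding r_def by (rule LeastI[of _ nr]) simp
  have rle: "r \<le> nr" unfolding r_def by (rule Least_le) simp
  have lt: "p k < nc" if "k < r" for k
    using not_less_Least[of k "\<lambda>i. i = nr \<or> p i = nc"] that rle P(1)[of k]
    unfolding r_def[symmetric] by fastforce
  have ge: "p i = nc" if "r \<le> i" "i < nr" for i
    using that
  proof (induction i rule: dec_induct)
    case base then show ?case using r by auto
  next
    case (step i) then show ?case using P(1)[of "Suc i"] P(3)[of i] by fastforce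
  qed
  show thesis
  proof (rule that[of G H r p])
    fix i k assume "i < nr" "k < r"
    then show "(G * A) $$ (i, p k) = (if i = k then 1 else 0)"
      using P(4)[of k] P(5)[of k i] lt rle GH(1) by auto
  next
    fix i j assume "r \<le> i" "i < nr" "j < nc"
    then show "(G * A) $$ (i, j) = 0" using P(2)[of i j] ge GH(1) by auto
  qed (use GH rle lt in auto)
qed

text \<open>Since \<open>Y\<close> is surjective, \<open>X * Y\<close> and \<open>X\<close> have the
  same column space; since \<open>L\<close> is a left inverse, the \<open>r\<close> columns of
  \<open>X\<close> are independent. Most later rank computations just exhibit such one-sided
  inverses.\<close>

lemma mat_rank_eqI:
  assumes X: "X \<in> carrier_mat nr r" and Y: "Y \<in> carrier_mat r nc"
    and L: "L \<in> carrier_mat r nr" and R: "R \<in> carrier_mat nc r"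
    and LX: "L * X = 1\<^sub>m r" and YR: "Y * R = 1\<^sub>m r"
  shows "mat_rank (X * Y) = r"
proof -
  interpret vec_space "TYPE(real)" nr .
  have XY: "X * Y \<in> carrier_mat nr nc" using X Y by simp
  have "col_space (X * Y) = col_space X"
  proof -
    have "\<exists>w\<in>carrier_vec r. X *\<^sub>v w = X * Y *\<^sub>v v" if "v \<in> carrier_vec nc" for v
      using that X Y by (intro bexI[of _ "Y *\<^sub>v v"]) auto
    moreover have "\<exists>v\<in>carrier_vec nc. X * Y *\<^sub>v v = X *\<^sub>v w" if w: "w \<in> carrier_vec r" for w
    proof (intro bexI[of _ "R *\<^sub>v w"])
      have "X * Y *\<^sub>v (R *\<^sub>v w) = X *\<^sub>v (Y * R *\<^sub>v w)"
        using w X Y R by (simp add: assoc_mult_mat_vec[of _ _ r])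
      then show "X * Y *\<^sub>v (R *\<^sub>v w) = X *\<^sub>v w" using YR w by simp
    qed (use w R in auto)
    ultimately show ?thesis
      unfolding col_space_eq[OF X] col_space_eq[OF XY] using X Y by fastforce
  qed
  then have "rank (X * Y) = rank X" unfolding rank_def col_space_def by simp
  also have "rank X = r"
  proof (rule lin_indpt_full_rank[OF X])
    have inj: "w = 0\<^sub>v r" if "w \<in> carrier_vec r" "X *\<^sub>v w = 0\<^sub>v nr" for w
    proof -
      have "w = L * X *\<^sub>v w" using LX that by simp
      also have "\<dots> = L *\<^sub>v 0\<^sub>v nr" using that L X by (simp add: assoc_mult_mat_vec[of _ _ nr])
      also have "\<dots> = 0\<^sub>v r" using L by (intro eq_vecI) auto
      finally show ?thesis .
    qed
    \<comment> \<open>Linear independence concerns the set of columns, so repetitions are excluded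
      separately: two equal columns of \<open>X\<close> would give equal columns of the identity
      \<open>L * X\<close>.\<close>
    show dist: "distinct (cols X)"
      unfolding distinct_conv_nth
    proof (intro allI impI)
      fix i j assume "i < length (cols X)" "j < length (cols X)" "i \<noteq> j"
      then have ij: "i < r" "j < r" "i \<noteq> j" using X by auto
      have "col (L * X) i \<noteq> col (L * X) j"
        unfolding LX using ij by (metis col_one index_unit_vec(1) index_unit_vec(2) zero_neq_one)
      then have "col X i \<noteq> col X j" using L X ij by (metis col_mult2)
      then show "cols X ! i \<noteq> cols X ! j" using ij X by simp
    qed
    show "lin_indpt (set (cols X))"
      using lin_depE[OF X _ dist] inj by metis
  qed
  finally show ?thesis unfolding mat_rank_def using X by simp
qed

text \<open>The row-reduced matrix \<open>G * A\<close> is \<open>J * Y\<close>, with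
  \<open>J\<close> the first \<open>r\<close> columns of the identity and \<open>Y\<close> the first
  \<open>r\<close> rows of \<open>G * A\<close>. The pivot columns form an identity block in
  \<open>Y\<close>, so the matrix \<open>R\<close> selecting them is a right inverse.\<close>

lemma pivots_factorization:
  fixes A :: "real mat"
  assumes A: "A \<in> carrier_mat nr nc" and G: "G \<in> carrier_mat nr nr" and H: "H \<in> carrier_mat nr nr"
    and GH: "G * H = 1\<^sub>m nr" "H * G = 1\<^sub>m nr" and r: "r \<le> nr" and p: "\<And>k. k < r \<Longrightarrow> p k < nc"
    and piv: "\<And>i k. i < nr \<Longrightarrow> k < r \<Longrightarrow> (G * A) $$ (i, p k) = (if i = k then 1 else 0)"
    and zero: "\<And>i j. r \<le> i \<Longrightarrow> i < nr \<Longrightarrow> j < nc \<Longrightarrow> (G * A) $$ (i, j) = 0"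
  obtains X Y L R where "X \<in> carrier_mat nr r" "Y \<in> carrier_mat r nc"
    "L \<in> carrier_mat r nr" "R \<in> carrier_mat nc r" "A = X * Y" "L * X = 1\<^sub>m r" "Y * R = 1\<^sub>m r"
proof -
  define J :: "real mat" where "J = mat nr r (\<lambda>(i, j). if i = j then 1 else 0)"
  define Y where "Y = mat r nc (\<lambda>(i, j). (G * A) $$ (i, j))"
  define R :: "real mat" where "R = mat nc r (\<lambda>(i, j). if i = p j then 1 else 0)"
  have J: "J \<in> carrier_mat nr r" and Y: "Y \<in> carrier_mat r nc" and R: "R \<in> carrier_mat nc r"
    unfolding J_def Y_def R_def by auto
  have JY: "J * Y = G * A"
  proof (rule eq_matI)
    fix i j assume "i < dim_row (G * A)" "j < dim_col (G * A)"
    then have ij: "i < nr" "j < nc" using G A by auto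
    have "(J * Y) $$ (i, j) = (\<Sum>k\<in>{0..<r}. (if i = k then 1 else 0) * (G * A) $$ (k, j))"
      using ij by (simp add: J_def Y_def scalar_prod_def)
    also have "\<dots> = (if i < r then (G * A) $$ (i, j) else 0)" by (simp add: if_distrib[of "\<lambda>x. x * _"] cong: if_cong)
    also have "\<dots> = (G * A) $$ (i, j)" using zero ij by auto
    finally show "(J * Y) $$ (i, j) = (G * A) $$ (i, j)" .
  qed (use G A J Y in auto)
  have JJ: "J\<^sup>T * J = 1\<^sub>m r"
  proof (rule eq_matI)
    fix i j assume "i < dim_row (1\<^sub>m r :: real mat)" "j < dim_col (1\<^sub>m r :: real mat)"
    then have ij: "i < r" "j < r" by auto
    have "(J\<^sup>T * J) $$ (i, j) = (\<Sum>k\<in>{0..<nr}. (if k = i then 1 else 0) * (if k = j then 1 else 0))"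
      using ij by (simp add: J_def scalar_prod_def)
    also have "\<dots> = (if i = j then 1 else 0)" using ij r by (simp add: if_distrib[of "\<lambda>x. x * _"] cong: if_cong)
    finally show "(J\<^sup>T * J) $$ (i, j) = (1\<^sub>m r) $$ (i, j)" using ij by simp
  qed (use J in auto)
  have YR: "Y * R = 1\<^sub>m r"
  proof (rule eq_matI)
    fix i j assume "i < dim_row (1\<^sub>m r :: real mat)" "j < dim_col (1\<^sub>m r :: real mat)"
    then have ij: "i < r" "j < r" by auto
    have "(Y * R) $$ (i, j) = (\<Sum>k\<in>{0..<nc}. (G * A) $$ (i, k) * (if k = p j then 1 else 0))"
      using ij by (simp add: Y_def R_def scalar_prod_def)
    also have "\<dots> = (G * A) $$ (i, p j)" using ij p by (simp add: if_distrib[of "\<lambda>x. _ * x"] cong: if_cong)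
    finally show "(Y * R) $$ (i, j) = (1\<^sub>m r) $$ (i, j)" using ij piv r by simp
  qed (use Y R in auto)
  have "(H * J) * Y = H * (G * A)"
    using H J Y JY by (simp add: assoc_mult_mat[of _ nr nr _ r _ nc])
  also have "\<dots> = (H * G) * A" using G H A by (simp add: assoc_mult_mat[of _ nr nr _ nr _ nc])
  finally have fact: "A = (H * J) * Y" using A GH by simp
  have "(J\<^sup>T * G) * (H * J) = J\<^sup>T * ((G * H) * J)"
    using G H J by (simp add: assoc_mult_mat[of _ _ nr _ nr _ r])
  then have left: "(J\<^sup>T * G) * (H * J) = 1\<^sub>m r" using GH J JJ by simp
  show thesis
    by (rule that[OF _ Y _ R fact left YR]) (use H J G in auto)
qed

text \<open>The factorization built from the pivots has inner dimension \<open>r\<close>, which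
  identifies the number of pivots with the rank.\<close>

lemma mat_rank_pivots:
  assumes A: "A \<in> carrier_mat nr nc"
  obtains G H p where "G \<in> carrier_mat nr nr" "H \<in> carrier_mat nr nr"
    "G * H = 1\<^sub>m nr" "H * G = 1\<^sub>m nr" "mat_rank A \<le> nr" "\<And>k. k < mat_rank A \<Longrightarrow> p k < nc"
    "\<And>i k. i < nr \<Longrightarrow> k < mat_rank A \<Longrightarrow> (G * A) $$ (i, p k) = (if i = k then 1 else 0)"
    "\<And>i j. mat_rank A \<le> i \<Longrightarrow> i < nr \<Longrightarrow> j < nc \<Longrightarrow> (G * A) $$ (i, j) = 0"
proof -
  obtain G H r p where piv: "G \<in> carrier_mat nr nr" "H \<in> carrier_mat nr nr"
    "G * H = 1\<^sub>m nr" "H * G = 1\<^sub>m nr" "r \<le> nr" "\<And>k. k < r \<Longrightarrow> p k < nc"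
    "\<And>i k. i < nr \<Longrightarrow> k < r \<Longrightarrow> (G * A) $$ (i, p k) = (if i = k then 1 else 0)"
    "\<And>i j. r \<le> i \<Longrightarrow> i < nr \<Longrightarrow> j < nc \<Longrightarrow> (G * A) $$ (i, j) = 0"
    using gauss_jordan_pivots[OF A] by blast
  obtain X Y L R where f: "X \<in> carrier_mat nr r" "Y \<in> carrier_mat r nc"
    "L \<in> carrier_mat r nr" "R \<in> carrier_mat nc r" "A = X * Y" "L * X = 1\<^sub>m r" "Y * R = 1\<^sub>m r"
    by (rule pivots_factorization[OF A piv])
  have "mat_rank A = r" using mat_rank_eqI[OF f(1-4,6,7)] f(5) by simp
  then show thesis using that[of G H p] piv by simp
qed

lemma mat_rank_factorization:
  assumes A: "A \<in> carrier_mat nr nc"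
  obtains X Y L R where "X \<in> carrier_mat nr (mat_rank A)" "Y \<in> carrier_mat (mat_rank A) nc"
    "L \<in> carrier_mat (mat_rank A) nr" "R \<in> carrier_mat nc (mat_rank A)"
    "A = X * Y" "L * X = 1\<^sub>m (mat_rank A)" "Y * R = 1\<^sub>m (mat_rank A)" "mat_rank A \<le> nr"
proof -
  obtain G H p where piv: "G \<in> carrier_mat nr nr" "H \<in> carrier_mat nr nr"
    "G * H = 1\<^sub>m nr" "H * G = 1\<^sub>m nr" "mat_rank A \<le> nr" "\<And>k. k < mat_rank A \<Longrightarrow> p k < nc"
    "\<And>i k. i < nr \<Longrightarrow> k < mat_rank A \<Longrightarrow> (G * A) $$ (i, p k) = (if i = k then 1 else 0)"
    "\<And>i j. mat_rank A \<le> i \<Longrightarrow> i < nr \<Longrightarrow> j < nc \<Longrightarrow> (G * A) $$ (i, j) = 0"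
    using mat_rank_pivots[OF A] by blast
  obtain X Y L R where "X \<in> carrier_mat nr (mat_rank A)" "Y \<in> carrier_mat (mat_rank A) nc"
    "L \<in> carrier_mat (mat_rank A) nr" "R \<in> carrier_mat nc (mat_rank A)"
    "A = X * Y" "L * X = 1\<^sub>m (mat_rank A)" "Y * R = 1\<^sub>m (mat_rank A)"
    by (rule pivots_factorization[OF A piv])
  then show thesis using that piv(5) by blast
qed


section \<open>Rank under one-sided invertible factors\<close>

lemma mat_rank_le:
  assumes "A \<in> carrier_mat nr nc"
  shows "mat_rank A \<le> nr" "mat_rank A \<le> nc"
  using mat_rank_factorization[OF assms] vec_space.rank_le_nc[OF assms] assms
  unfolding mat_rank_def by auto

text \<open>One-sided inverses compose: a full-rank factorization of \<open>W\<close> becomes one of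
  \<open>X * W\<close> with the same inner dimension.\<close>

lemma mat_rank_mult_left:
  assumes X: "X \<in> carrier_mat nr s" and W: "W \<in> carrier_mat s nc"
    and L: "L \<in> carrier_mat s nr" and LX: "L * X = 1\<^sub>m s"
  shows "mat_rank (X * W) = mat_rank W"
proof -
  define r where "r = mat_rank W"
  obtain X' Y' L' R' where f: "X' \<in> carrier_mat s r" "Y' \<in> carrier_mat r nc" "L' \<in> carrier_mat r s"
    "R' \<in> carrier_mat nc r" "W = X' * Y'" "L' * X' = 1\<^sub>m r" "Y' * R' = 1\<^sub>m r"
    using mat_rank_factorization[OF W] unfolding r_def by metis
  have eq: "X * W = (X * X') * Y'" using X f by (simp add: assoc_mult_mat[of _ nr s _ r _ nc])
  have "(L' * L) * (X * X') = L' * ((L * X) * X')"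
    using X L f(1-4) by (simp add: assoc_mult_mat[of _ _ nr _ s _ r] assoc_mult_mat[of _ r s _ nr _ r])
  then have "(L' * L) * (X * X') = 1\<^sub>m r" using LX f by simp
  then show ?thesis
    unfolding eq r_def[symmetric] by (intro mat_rank_eqI[OF _ f(2) _ f(4) _ f(7)]) (use X L f in auto)
qed

lemma mat_rank_mult_right:
  assumes Y: "Y \<in> carrier_mat s nc" and W: "W \<in> carrier_mat nr s"
    and R: "R \<in> carrier_mat nc s" and YR: "Y * R = 1\<^sub>m s"
  shows "mat_rank (W * Y) = mat_rank W"
proof -
  define r where "r = mat_rank W"
  obtain X' Y' L' R' where f: "X' \<in> carrier_mat nr r" "Y' \<in> carrier_mat r s" "L' \<in> carrier_mat r nr"
    "R' \<in> carrier_mat s r" "W = X' * Y'" "L' * X' = 1\<^sub>m r" "Y' * R' = 1\<^sub>m r"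
    using mat_rank_factorization[OF W] unfolding r_def by metis
  have eq: "W * Y = X' * (Y' * Y)" using Y f by (simp add: assoc_mult_mat[of _ nr r _ s _ nc])
  have "(Y' * Y) * (R * R') = Y' * ((Y * R) * R')"
    using Y R f(1-4) by (simp add: assoc_mult_mat[of _ _ s _ nc _ r] assoc_mult_mat[of _ s nc _ s _ r])
  then have "(Y' * Y) * (R * R') = 1\<^sub>m r" using YR f by simp
  then show ?thesis
    unfolding eq r_def[symmetric] by (intro mat_rank_eqI[OF f(1) _ f(3) _ f(6)]) (use Y R f in auto)
qed

text \<open>Here the factor \<open>X\<close> is square, so its left inverse \<open>L\<close> is also
  a right inverse, and \<open>R * L\<close> inverts \<open>X * Y\<close> from the right.\<close>

lemma full_row_rank_right_inverse:
  assumes A: "A \<in> carrier_mat (mat_rank A) nc"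
  obtains R where "R \<in> carrier_mat nc (mat_rank A)" "A * R = 1\<^sub>m (mat_rank A)"
proof -
  define r where "r = mat_rank A"
  have A': "A \<in> carrier_mat r nc" using A unfolding r_def .
  obtain X Y L R where f: "X \<in> carrier_mat r r" "Y \<in> carrier_mat r nc" "L \<in> carrier_mat r r"
    "R \<in> carrier_mat nc r" "A = X * Y" "L * X = 1\<^sub>m r" "Y * R = 1\<^sub>m r"
    using mat_rank_factorization[OF A'] unfolding r_def by metis
  have "A * (R * L) = X * ((Y * R) * L)"
    using f(1-5) by (simp add: assoc_mult_mat[of _ _ r _ nc _ r] assoc_mult_mat[of _ r nc _ r _ r])
  also have "\<dots> = X * L" unfolding f(7) using f by simp
  also have "\<dots> = 1\<^sub>m r" using mat_mult_left_right_inverse[OF f(3,1,6)] .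
  finally show thesis using that[of "R * L"] f unfolding r_def by auto
qed

lemma full_col_rank_left_inverse:
  assumes A: "A \<in> carrier_mat nr (mat_rank A)"
  obtains L where "L \<in> carrier_mat (mat_rank A) nr" "L * A = 1\<^sub>m (mat_rank A)"
proof -
  define r where "r = mat_rank A"
  have A': "A \<in> carrier_mat nr r" using A unfolding r_def .
  obtain X Y L R where f: "X \<in> carrier_mat nr r" "Y \<in> carrier_mat r r" "L \<in> carrier_mat r nr"
    "R \<in> carrier_mat r r" "A = X * Y" "L * X = 1\<^sub>m r" "Y * R = 1\<^sub>m r"
    using mat_rank_factorization[OF A'] unfolding r_def by metis
  have "(R * L) * A = R * ((L * X) * Y)"
    using f(1-5) by (simp add: assoc_mult_mat[of _ _ nr _ r _ r] assoc_mult_mat[of _ r r _ nr _ r])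
  also have "\<dots> = R * Y" unfolding f(6) using f by simp
  also have "\<dots> = 1\<^sub>m r" using mat_mult_left_right_inverse[OF f(2,4,7)] .
  finally show thesis using that[of "R * L"] f unfolding r_def by auto
qed

lemma invertible_iff_mat_rank:
  assumes A: "A \<in> carrier_mat n n"
  shows "invertible_mat A \<longleftrightarrow> mat_rank A = n"
proof
  assume "invertible_mat A"
  note inv = minv[OF A this]
  have "mat_rank (A * 1\<^sub>m n) = n"
    by (rule mat_rank_eqI[OF A one_carrier_mat inv(1) one_carrier_mat inv(3)]) simp
  then show "mat_rank A = n" using A by simp
next
  assume "mat_rank A = n"
  then obtain R where "R \<in> carrier_mat n n" "A * R = 1\<^sub>m n"
    using full_row_rank_right_inverse[of A n] A by metis
  then show "invertible_mat A" using invertible_matI[OF A] by blast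
qed

lemma mat_rank_eq_0_iff:
  assumes A: "A \<in> carrier_mat nr nc"
  shows "mat_rank A = 0 \<longleftrightarrow> A = 0\<^sub>m nr nc"
proof
  assume r: "mat_rank A = 0"
  obtain X Y where "X \<in> carrier_mat nr 0" "Y \<in> carrier_mat 0 nc" "A = X * Y"
    using mat_rank_factorization[OF A] unfolding r by metis
  then show "A = 0\<^sub>m nr nc" by (intro eq_matI) (auto simp: scalar_prod_def)
next
  assume "A = 0\<^sub>m nr nc"
  then show "mat_rank A = 0" unfolding mat_rank_def by (simp add: vec_space.rank_0I)
qed

section \<open>Kernels, ranks of powers and the index\<close>

lemma mat_rank_le_of_kernel_subset:
  assumes A: "A \<in> carrier_mat nr nc" and B: "B \<in> carrier_mat nr' nc"
    and sub: "mat_kernel A \<subseteq> mat_kernel B"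
  shows "mat_rank B \<le> mat_rank A" "mat_rank B = mat_rank A \<Longrightarrow> mat_kernel A = mat_kernel B"
proof -
  define r where "r = mat_rank A"
  obtain X Y L R where f: "X \<in> carrier_mat nr r" "Y \<in> carrier_mat r nc" "L \<in> carrier_mat r nr"
    "R \<in> carrier_mat nc r" "A = X * Y" "L * X = 1\<^sub>m r" "Y * R = 1\<^sub>m r"
    using mat_rank_factorization[OF A] unfolding r_def by metis
  \<comment> \<open>\<open>D\<close> is the projection onto the kernel of \<open>A\<close> along the
    range of \<open>R\<close>. As \<open>B\<close> vanishes on this kernel, \<open>B * D\<close> is
    zero, so \<open>B = (B * R) * Y\<close> factors through \<open>Y\<close> and has rank at most
    \<open>r\<close>.\<close>
  define D where "D = 1\<^sub>m nc - R * Y"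
  have D: "D \<in> carrier_mat nc nc" unfolding D_def using mult_carrier_mat[OF f(4,2)] by (rule minus_carrier_mat)
  have "A * D = A - X * ((Y * R) * Y)"
    unfolding D_def using f(1-5) A
    by (simp add: mult_minus_distrib_mat[of _ nr nc _ nc] assoc_mult_mat[of _ nr r _ nc _ nc]
        assoc_mult_mat[of _ r nc _ r _ nc])
  also have "\<dots> = 0\<^sub>m nr nc" unfolding f(7) using f A by simp
  finally have AD: "A * D = 0\<^sub>m nr nc" .
  have BD: "B * D = 0\<^sub>m nr' nc"
  proof (rule mat_col_eqI)
    fix j assume "j < dim_col (0\<^sub>m nr' nc :: real mat)"
    then have j: "j < nc" by simp
    have "A *\<^sub>v col D j = 0\<^sub>v nr" using AD col_mult2[OF A D j] j by simp
    then have "col D j \<in> mat_kernel B"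
      using sub mat_kernelI[OF A] D j by (metis col_carrier_vec subsetD)
    then show "col (B * D) j = col (0\<^sub>m nr' nc) j"
      using col_mult2[OF B D j] mat_kernelD[OF B] j by simp
  qed (use B D in auto)
  have BR: "B * R \<in> carrier_mat nr' r" using B f by simp
  have "B * D = B - (B * R) * Y"
    unfolding D_def using f B
    by (simp add: mult_minus_distrib_mat[of _ nr' nc _ nc] assoc_mult_mat[of _ nr' nc _ r _ nc])
  then have "B - (B * R) * Y = 0\<^sub>m nr' nc" using BD by simp
  then have eq: "B = (B * R) * Y"
    using B BR f(2) by (auto simp: mat_eq_iff)
  have rank: "mat_rank B = mat_rank (B * R)"
    by (subst eq) (rule mat_rank_mult_right[OF f(2) BR f(4,7)])
  then show "mat_rank B \<le> mat_rank A" using mat_rank_le(2)[OF BR] unfolding r_def by simp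
  \<comment> \<open>With equal ranks \<open>B * R\<close> has independent columns; a left inverse
    \<open>M\<close> recovers \<open>Y\<close> as \<open>M * B\<close>, and \<open>A = X * Y\<close>
    becomes a left multiple of \<open>B\<close>.\<close>
  assume "mat_rank B = mat_rank A"
  then have "mat_rank (B * R) = r" using rank r_def by simp
  then obtain M where M: "M \<in> carrier_mat r nr'" "M * (B * R) = 1\<^sub>m r"
    using full_col_rank_left_inverse[of "B * R"] BR by metis
  have "A = X * (M * (B * R)) * Y" unfolding M(2) using f by simp
  also have "\<dots> = (X * M) * (B * R * Y)"
    using f(1-4) M(1) BR
    by (simp add: assoc_mult_mat[of _ nr r _ r _ nc] assoc_mult_mat[of X nr r M nr' _ nc]
        assoc_mult_mat[of M r nr' _ r _ nc])
  also have "\<dots> = (X * M) * B" using eq by metis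
  finally have "mat_kernel B \<subseteq> mat_kernel A"
    using mat_kernel_mult_subset[OF B] f(1) M(1) by (metis mult_carrier_mat)
  then show "mat_kernel A = mat_kernel B" using sub by blast
qed

lemma mat_kernel_pow_subset:
  fixes B :: "real mat"
  assumes B: "B \<in> carrier_mat n n"
  shows "mat_kernel (B ^\<^sub>m k) \<subseteq> mat_kernel (B ^\<^sub>m Suc k)"
proof -
  have "B * B ^\<^sub>m k = B ^\<^sub>m Suc k"
  proof (induction k)
    case (Suc k)
    have "B * B ^\<^sub>m Suc k = (B * B ^\<^sub>m k) * B"
      using B pow_carrier_mat[OF B, of k] by (simp add: assoc_mult_mat[of _ n n _ n _ n])
    then show ?case using Suc by simp
  qed (use B in simp)
  then show ?thesis using mat_kernel_mult_subset[OF pow_carrier_mat[OF B] B] by metis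
qed

text \<open>\<open>LEAST\<close> has meaning only once some kernel repeats, which finiteness of the
  rank guarantees. At the index the two kernels agree, hence the two ranks, so no exponent below
  \<open>k\<close> can be the index.\<close>

lemma mat_index_geI:
  assumes B: "B \<in> carrier_mat n n" and neq: "\<And>j. j < k \<Longrightarrow> mat_rank (B ^\<^sub>m Suc j) \<noteq> mat_rank (B ^\<^sub>m j)"
  shows "k \<le> mat_index B"
proof -
  note pow = pow_carrier_mat[OF B]
  note rank = mat_rank_le_of_kernel_subset[OF pow pow mat_kernel_pow_subset[OF B]]
  have "\<exists>k. mat_rank (B ^\<^sub>m Suc k) = mat_rank (B ^\<^sub>m k)"
  proof (rule ccontr)
    assume *: "\<not> ?thesis"
    \<comment> \<open>If no two consecutive ranks agreed, each exponent would use up at least one of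
      the \<open>n\<close> available units of rank.\<close>
    have "mat_rank (B ^\<^sub>m k) + k \<le> n" for k
    proof (induction k)
      case 0 then show ?case using mat_rank_le(1)[OF pow, of 0] by simp
    next
      case (Suc k)
      have "mat_rank (B ^\<^sub>m Suc k) < mat_rank (B ^\<^sub>m k)" using * rank(1)[of k] by (metis order_less_le)
      then show ?case using Suc by linarith
    qed
    from this[of "Suc n"] show False by simp
  qed
  then have "\<exists>k. mat_kernel (B ^\<^sub>m k) = mat_kernel (B ^\<^sub>m Suc k)" using rank(2) by metis
  then have "mat_kernel (B ^\<^sub>m mat_index B) = mat_kernel (B ^\<^sub>m Suc (mat_index B))"
    unfolding mat_index_def by (rule LeastI_ex)
  then have "mat_rank (B ^\<^sub>m Suc (mat_index B)) = mat_rank (B ^\<^sub>m mat_index B)"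
    using mat_rank_le_of_kernel_subset(1)[OF pow pow] by (metis order_antisym order_refl)
  then show ?thesis using neq by (metis not_le)
qed

section \<open>Schur complements and the algebra of a deflation step\<close>


lemma minus_add_cancel_mat:
  fixes A B :: "real mat"
  assumes "A \<in> carrier_mat a b" "B \<in> carrier_mat a b"
  shows "A - B + B = A"
  using assms by (intro eq_matI) auto

lemma smult_minus_add_minus_mat:
  fixes A B X Y :: "real mat"
  assumes "A \<in> carrier_mat a b" "B \<in> carrier_mat a b" "X \<in> carrier_mat a b" "Y \<in> carrier_mat a b"
  shows "l \<cdot>\<^sub>m (A - X) + (B - Y) = (l \<cdot>\<^sub>m A + B) - (l \<cdot>\<^sub>m X + Y)"
  using assms by (intro eq_matI) (auto simp: algebra_simps)

text \<open>The block row (A, B) applied to the block column (Z, -C D Z). With C = N^-1 and D = M,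
  the row (M, N) sends this column to zero, so one identity serves for both block rows of an
  elimination.\<close>

lemma schur_complement_mult:
  fixes A B C D Z :: "real mat"
  assumes A: "A \<in> carrier_mat a b" and B: "B \<in> carrier_mat a m" and C: "C \<in> carrier_mat m m"
    and D: "D \<in> carrier_mat m b" and Z: "Z \<in> carrier_mat b c"
  shows "A * Z + B * - (C * D * Z) = (A - B * C * D) * Z"
proof -
  have c: "B * C * D \<in> carrier_mat a b" "C * D * Z \<in> carrier_mat m c" "A * Z \<in> carrier_mat a c"
    "B * (C * D * Z) \<in> carrier_mat a c" using assms by auto
  have "B * C * D * Z = B * (C * D * Z)"
    using assms by (simp add: assoc_mult_mat[of _ a m _ m _ c] assoc_mult_mat[of _ a m _ b _ c]
        assoc_mult_mat[of _ m m _ b _ c] assoc_mult_mat[of _ a m _ m _ b])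
  moreover have "B * - (C * D * Z) = - (B * (C * D * Z))" using B c(2) by (intro uminus_mult_right_mat) auto
  ultimately show ?thesis
    unfolding minus_mult_distrib_mat[OF A c(1) Z] using add_uminus_minus_mat[OF c(3,4)] by simp
qed

text \<open>Block elimination with \<open>N\<close> as pivot. A full-rank factorization X Y of the
  Schur complement extends to the factors (X, L N^-1; 0, 1) and (Y, 0; M, N), whose inner dimension
  is r + m and whose one-sided inverses are again block triangular.\<close>

lemma mat_rank_schur_complement:
  assumes K: "K \<in> carrier_mat a b" and L: "L \<in> carrier_mat a m" and M: "M \<in> carrier_mat m b"
    and N: "N \<in> carrier_mat m m" and inv: "invertible_mat N"
  shows "mat_rank (four_block_mat K L M N) = mat_rank (K - L * minv N * M) + m"
proof -
  define Ni where "Ni = minv N"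
  note Ni = minv[OF N inv, folded Ni_def]
  define r where "r = mat_rank (K - L * Ni * M)"
  have LNM: "L * Ni * M \<in> carrier_mat a b" using L Ni M by simp
  then have Z: "K - L * Ni * M \<in> carrier_mat a b" by (rule minus_carrier_mat)
  obtain X Y P Q where f: "X \<in> carrier_mat a r" "Y \<in> carrier_mat r b" "P \<in> carrier_mat r a"
    "Q \<in> carrier_mat b r" "K - L * Ni * M = X * Y" "P * X = 1\<^sub>m r" "Y * Q = 1\<^sub>m r"
    using mat_rank_factorization[OF Z] unfolding r_def by metis
  have K': "X * Y + L * Ni * M = K"
    unfolding f(5)[symmetric] by (rule minus_add_cancel_mat[OF K LNM])
  have c: "L * Ni \<in> carrier_mat a m" "Ni * M \<in> carrier_mat m b" "M * Q \<in> carrier_mat m r"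
    "P * (L * Ni) \<in> carrier_mat r m" "Ni * M * Q \<in> carrier_mat m r"
    using L Ni M f by auto
  have X': "four_block_mat X (L * Ni) (0\<^sub>m m r) (1\<^sub>m m) \<in> carrier_mat (a + m) (r + m)"
    and Y': "four_block_mat Y (0\<^sub>m r m) M N \<in> carrier_mat (r + m) (b + m)"
    using f N by auto
  have fact: "four_block_mat K L M N = four_block_mat X (L * Ni) (0\<^sub>m m r) (1\<^sub>m m) * four_block_mat Y (0\<^sub>m r m) M N"
  proof -
    have "L * Ni * N = L" using L N Ni by (simp add: assoc_mult_mat[of _ a m _ m _ m])
    then show ?thesis
      using f(1,2) c L M N K by (subst mult_four_block_mat[of _ a r _ m _ m _ _ b _ m]) (auto simp: K')
  qed
  have left: "four_block_mat P (- (P * (L * Ni))) (0\<^sub>m m a) (1\<^sub>m m)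
      * four_block_mat X (L * Ni) (0\<^sub>m m r) (1\<^sub>m m) = 1\<^sub>m (r + m)"
  proof -
    have "P * X + - (P * (L * Ni)) * 0\<^sub>m m r = 1\<^sub>m r"
      using right_mult_zero_mat[of "- (P * (L * Ni))" r m r] c(4) f(6) by simp
    moreover have "P * (L * Ni) + - (P * (L * Ni)) * 1\<^sub>m m = 0\<^sub>m r m"
      using right_mult_one_mat[OF uminus_carrier_mat[OF c(4)]] add_uminus_minus_mat[OF c(4,4)]
        minus_r_inv_mat[OF c(4)] by simp
    moreover have "0\<^sub>m m a * X + 1\<^sub>m m * 0\<^sub>m m r = 0\<^sub>m m r" "0\<^sub>m m a * (L * Ni) + 1\<^sub>m m * 1\<^sub>m m = 1\<^sub>m m"
      using f(1) left_mult_zero_mat[OF c(1)] by simp_all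
    ultimately show ?thesis
      using mult_four_block_mat[OF f(3) uminus_carrier_mat[OF c(4)] zero_carrier_mat one_carrier_mat
          f(1) c(1) zero_carrier_mat one_carrier_mat] by simp
  qed
  have right: "four_block_mat Y (0\<^sub>m r m) M N * four_block_mat Q (0\<^sub>m b m) (- (Ni * M * Q)) Ni = 1\<^sub>m (r + m)"
  proof -
    have "M * Q + N * - (Ni * M * Q) = 0\<^sub>m m r"
      using schur_complement_mult[OF M N Ni(1) M f(4)] Ni(2) M f(4) by simp
    moreover have "Y * Q + 0\<^sub>m r m * - (Ni * M * Q) = 1\<^sub>m r" "Y * 0\<^sub>m b m + 0\<^sub>m r m * Ni = 0\<^sub>m r m"
      "M * 0\<^sub>m b m + N * Ni = 1\<^sub>m m"
      using left_mult_zero_mat[OF uminus_carrier_mat[OF c(5)]] f(7) f(2) M Ni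
      by (simp_all del: uminus_mult_right_mat)
    ultimately show ?thesis
      using mult_four_block_mat[OF f(2) zero_carrier_mat M N f(4) zero_carrier_mat
          uminus_carrier_mat[OF c(5)] Ni(1)] by simp
  qed
  show ?thesis
    unfolding fact Ni_def[symmetric] r_def[symmetric]
    by (rule mat_rank_eqI[OF X' Y' _ _ left right]) (use f Ni in auto)
qed

text \<open>Regrouping of the alternating product X R X R ... X R. If \<open>X\<close> is
  left-invertible and \<open>R\<close> right-invertible, the outer factors do not affect the rank,
  so the smaller matrix \<open>R * X\<close> carries the ranks of the powers.\<close>

lemma pow_mat_mult_swap:
  fixes X R :: "real mat"
  assumes X: "X \<in> carrier_mat n r" and R: "R \<in> carrier_mat r n"
  shows "(X * R) ^\<^sub>m Suc k = X * (R * X) ^\<^sub>m k * R"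
proof (induction k)
  case 0 then show ?case using X R by simp
next
  case (Suc k)
  have p: "(R * X) ^\<^sub>m k \<in> carrier_mat r r" using X R by simp
  have assoc: "(X * Q * R) * (X * R) = X * (Q * (R * X)) * R" if "Q \<in> carrier_mat r r" for Q
    using X R that by (simp add: assoc_mult_mat[of _ n r _ r _ n] assoc_mult_mat[of _ r r _ r _ n]
        assoc_mult_mat[of _ n r _ n _ n] assoc_mult_mat[of _ r r _ n _ n] assoc_mult_mat[of _ r n _ r _ n])
  have "(X * R) ^\<^sub>m Suc (Suc k) = (X * (R * X) ^\<^sub>m k * R) * (X * R)" using Suc by simp
  also have "\<dots> = X * ((R * X) ^\<^sub>m k * (R * X)) * R"
    by (rule assoc[OF p])
  finally show ?case by simp
qed

section \<open>Permutations and the block algebra of a single step\<close>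

lemma permutation_matrix_inverse:
  assumes "permutation_matrix n P"
  shows "P \<in> carrier_mat n n" "P\<^sup>T * P = 1\<^sub>m n" "P * P\<^sup>T = 1\<^sub>m n"
proof -
  obtain p where p: "p permutes {..<n}" and P: "P = mat n n (\<lambda>(i, j). if i = p j then 1 else 0)"
    using assms unfolding permutation_matrix_def by blast
  show c: "P \<in> carrier_mat n n" unfolding P by simp
  show l: "P\<^sup>T * P = 1\<^sub>m n"
  proof (rule eq_matI)
    fix i j assume "i < dim_row (1\<^sub>m n :: real mat)" "j < dim_col (1\<^sub>m n :: real mat)"
    then have ij: "i < n" "j < n" by auto
    have "(P\<^sup>T * P) $$ (i, j) = (\<Sum>k\<in>{0..<n}. (if k = p i then 1 else 0) * (if k = p j then 1 else 0))"
      using ij by (simp add: P scalar_prod_def)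
    also have "\<dots> = (if p i = p j then 1 else 0)"
      using ij permutes_in_image[OF p, of i] by (simp add: if_distrib[of "\<lambda>x. x * _"] cong: if_cong)
    finally show "(P\<^sup>T * P) $$ (i, j) = (1\<^sub>m n) $$ (i, j)"
      using ij permutes_inj[OF p] by (simp add: inj_eq)
  qed (use c in auto)
  show "P * P\<^sup>T = 1\<^sub>m n" using mat_mult_left_right_inverse[OF _ c l] c by simp
qed

text \<open>\<open>E1\<close> and \<open>A1\<close> eliminate through the same \<open>M\<close> and
  \<open>N\<close>, so l E1 + A1 is exactly the Schur complement of \<open>N\<close> in the
  transformed l E + A, for the same l. This carries regularity over and gives the block inverse
  behind the last conclusion.\<close>

lemma deflation_algebra:
  assumes E: "E \<in> carrier_mat n n" and A: "A \<in> carrier_mat n n" and r: "mat_rank E = r"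
    and reg: "invertible_mat (l \<cdot>\<^sub>m E + A)"
    and U: "U \<in> carrier_mat n n" "invertible_mat U" and P: "permutation_matrix n P"
    and c: "S \<in> carrier_mat r r" "K \<in> carrier_mat r r" "T \<in> carrier_mat r (n - r)"
      "L \<in> carrier_mat r (n - r)" "M \<in> carrier_mat (n - r) r" "N \<in> carrier_mat (n - r) (n - r)"
    and N: "invertible_mat N"
    and blockE: "minv U * E * P = four_block_mat S T (0\<^sub>m (n - r) r) (0\<^sub>m (n - r) (n - r))"
    and blockA: "minv U * A * P = four_block_mat K L M N"
    and E1: "E1 = S - T * minv N * M" and A1: "A1 = K - L * minv N * M"
  shows "E1 \<in> carrier_mat r r" "A1 \<in> carrier_mat r r" "invertible_mat (l \<cdot>\<^sub>m E1 + A1)"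
    "mat_rank A = mat_rank A1 + (n - r)"
    "mat_rank ((minv (l \<cdot>\<^sub>m E1 + A1) * E1) ^\<^sub>m k) = mat_rank ((minv (l \<cdot>\<^sub>m E + A) * E) ^\<^sub>m Suc k)"
proof -
  define m where "m = n - r"
  have rn: "r \<le> n" using mat_rank_le(1)[OF E] r by simp
  then have n: "n = r + m" "n - r = m" unfolding m_def by auto
  note c = c[unfolded n(2)]
  define Ni where "Ni = minv N"
  note Ni = minv[OF c(6) N, folded Ni_def]
  define V where "V = minv U"
  note V = minv[OF U, folded V_def]
  note P = permutation_matrix_inverse[OF P]
  have PT: "P\<^sup>T \<in> carrier_mat n n" using P(1) by simp
  define G where "G = l \<cdot>\<^sub>m E + A"
  have G: "G \<in> carrier_mat n n" unfolding G_def using E A by simp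
  note Gi = minv[OF G reg[folded G_def]]
  show E1c: "E1 \<in> carrier_mat r r" and A1c: "A1 \<in> carrier_mat r r"
    unfolding E1 A1 Ni_def[symmetric] using c Ni by (auto intro!: minus_carrier_mat)
  have rank_trans: "mat_rank (V * B * P) = mat_rank B" if B: "B \<in> carrier_mat n n" for B
  proof -
    have "mat_rank (V * B * P) = mat_rank (V * B)"
      by (rule mat_rank_mult_right[OF P(1) _ PT P(3)]) (use V B in auto)
    also have "\<dots> = mat_rank B" by (rule mat_rank_mult_left[OF V(1) B U(1) V(2)])
    finally show ?thesis .
  qed
  note schur = mat_rank_schur_complement[OF _ _ c(5,6) N, folded Ni_def]
  show "mat_rank A = mat_rank A1 + (n - r)"
    using rank_trans[OF A] schur[OF c(2,4)] n(2) unfolding A1 V_def[symmetric] blockA[folded V_def] Ni_def by simp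
  define G1 where "G1 = l \<cdot>\<^sub>m E1 + A1"
  have G1c: "G1 \<in> carrier_mat r r" unfolding G1_def using E1c A1c by simp
  have VGP: "V * G * P = four_block_mat (l \<cdot>\<^sub>m S + K) (l \<cdot>\<^sub>m T + L) M N"
  proof -
    have "V * G * P = l \<cdot>\<^sub>m (V * E * P) + V * A * P"
      unfolding G_def using V E A P
      by (simp add: mult_add_distrib_mat[of _ n n _ n] add_mult_distrib_mat[of _ n n _ _ n] mult_smult_distrib
          smult_carrier_mat mult_smult_assoc_mat[of _ n n _ n])
    also have "\<dots> = four_block_mat (l \<cdot>\<^sub>m S + K) (l \<cdot>\<^sub>m T + L) M N"
      unfolding V_def blockE blockA n(2) using c by (intro eq_matI) auto
    finally show ?thesis .
  qed
  have G1: "G1 = (l \<cdot>\<^sub>m S + K) - (l \<cdot>\<^sub>m T + L) * Ni * M"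
  proof -
    have "(l \<cdot>\<^sub>m T + L) * Ni * M = l \<cdot>\<^sub>m (T * Ni * M) + L * Ni * M"
      using c Ni by (simp add: add_mult_distrib_mat[of _ r m _ _ m] add_mult_distrib_mat[of _ r m _ _ r]
          mult_smult_assoc_mat[of _ r m])
    moreover have "T * Ni * M \<in> carrier_mat r r" "L * Ni * M \<in> carrier_mat r r" using c Ni by auto
    ultimately show ?thesis
      unfolding G1_def E1 A1 Ni_def[symmetric] using smult_minus_add_minus_mat[OF c(1,2)] by metis
  qed
  have GL: "l \<cdot>\<^sub>m S + K \<in> carrier_mat r r" "l \<cdot>\<^sub>m T + L \<in> carrier_mat r m" using c(1-4) by auto
  have "mat_rank G1 + m = n"
    using schur[OF GL] rank_trans[OF G]
      invertible_iff_mat_rank[OF G] reg unfolding G1 G_def[symmetric] VGP by simp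
  then have "mat_rank G1 = r" using n(1) by simp
  then show reg1: "invertible_mat (l \<cdot>\<^sub>m E1 + A1)"
    using invertible_iff_mat_rank[OF G1c] unfolding G1_def by simp
  define Z where "Z = minv G1"
  note Z = minv[OF G1c reg1[folded G1_def], folded Z_def]
  \<comment> \<open>\<open>J\<close> is the block column (1; 0) and \<open>W\<close> the block row
    (S, T), padded with blocks of width or height zero so that the block product rule
    applies.\<close>
  define J :: "real mat" where "J = four_block_mat (1\<^sub>m r) (0\<^sub>m r 0) (0\<^sub>m m r) (0\<^sub>m m 0)"
  define W where "W = four_block_mat S T (0\<^sub>m 0 r) (0\<^sub>m 0 m)"
  \<comment> \<open>the first block column of the inverse of the transformed matrix \<open>V * G * P\<close>\<close>
  define X0 where "X0 = four_block_mat Z (0\<^sub>m r 0) (- (Ni * M * Z)) (0\<^sub>m m 0)"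
  have cc: "J \<in> carrier_mat n r" "W \<in> carrier_mat r n" "X0 \<in> carrier_mat n r"
    unfolding J_def W_def X0_def n(1) using c Z by (auto intro!: carrier_matI)
  have JW: "J * W = V * E * P"
    unfolding J_def W_def V_def blockE n(2) using c
    by (subst mult_four_block_mat[of _ r r _ 0 _ m _ _ r _ m]) auto
  have JJ: "J\<^sup>T * J = 1\<^sub>m r"
    unfolding J_def by (subst transpose_four_block_mat[of _ r r _ 0 _ m], (simp; fail)+)
     (subst mult_four_block_mat[of _ r r _ m _ 0 _ _ r _ 0], auto intro!: eq_matI)
  have NMZ: "Ni * M * Z \<in> carrier_mat m r" using c Ni Z by simp
  have GX: "V * G * P * X0 = J"
  proof -
    have a: "(l \<cdot>\<^sub>m S + K) * Z + (l \<cdot>\<^sub>m T + L) * - (Ni * M * Z) = 1\<^sub>m r"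
      using schur_complement_mult[OF GL Ni(1) c(5) Z(1)] Z(2) unfolding G1 by simp
    have b: "M * Z + N * - (Ni * M * Z) = 0\<^sub>m m r"
      using schur_complement_mult[OF c(5,6) Ni(1) c(5) Z(1)] Ni(2) c(5) Z(1) by simp
    have z: "(l \<cdot>\<^sub>m S + K) * 0\<^sub>m r 0 + (l \<cdot>\<^sub>m T + L) * 0\<^sub>m m 0 = 0\<^sub>m r 0"
      "M * 0\<^sub>m r 0 + N * 0\<^sub>m m 0 = 0\<^sub>m m 0" using GL c by (auto intro!: eq_matI)
    show ?thesis
      unfolding VGP X0_def J_def mult_four_block_mat[OF GL c(5,6) Z(1) zero_carrier_mat
          uminus_carrier_mat[OF NMZ] zero_carrier_mat] a b z ..
  qed
  have WX: "W * X0 = E1 * Z"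
  proof -
    have "S * Z + T * - (Ni * M * Z) = E1 * Z"
      using schur_complement_mult[OF c(1,3) Ni(1) c(5) Z(1)] unfolding E1 Ni_def by simp
    moreover have "0\<^sub>m 0 r * Z + 0\<^sub>m 0 m * - (Ni * M * Z) = 0\<^sub>m 0 r" using Z NMZ by (auto intro!: eq_matI)
    moreover have "S * 0\<^sub>m r 0 + T * 0\<^sub>m m 0 = 0\<^sub>m r 0" using c by (auto intro!: eq_matI)
    moreover have "0\<^sub>m 0 r * 0\<^sub>m r 0 + 0\<^sub>m 0 m * 0\<^sub>m m 0 = 0\<^sub>m 0 (0 :: nat)" by (auto intro!: eq_matI)
    moreover have "four_block_mat (E1 * Z) (0\<^sub>m r 0) (0\<^sub>m 0 r) (0\<^sub>m 0 0) = E1 * Z"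
      using E1c Z(1) by (intro eq_matI) auto
    ultimately show ?thesis
      unfolding W_def X0_def mult_four_block_mat[OF c(1,3) zero_carrier_mat zero_carrier_mat Z(1)
          zero_carrier_mat uminus_carrier_mat[OF NMZ] zero_carrier_mat] by metis
  qed
  \<comment> \<open>The permutation is undone here: \<open>V * E = J * R\<close> and
    \<open>V * G * X = J\<close>, so that \<open>G * (X * R) = E\<close>.\<close>
  define X where "X = P * X0"
  define R where "R = W * P\<^sup>T"
  have Xc: "X \<in> carrier_mat n r" and Rc: "R \<in> carrier_mat r n" unfolding X_def R_def using cc P(1) by auto
  have RX: "R * X = E1 * Z"
  proof -
    have "R * X = W * ((P\<^sup>T * P) * X0)"
      unfolding R_def X_def using cc P(1)
      by (simp add: assoc_mult_mat[of _ r n _ n _ r] assoc_mult_mat[of _ n n _ n _ r])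
    then show ?thesis unfolding P(2) using cc WX by simp
  qed
  have EJR: "V * E = J * R"
  proof -
    have "J * R = (J * W) * P\<^sup>T" unfolding R_def using cc P(1) by (simp add: assoc_mult_mat[of _ n r _ n _ n])
    also have "\<dots> = V * E * (P * P\<^sup>T)"
      unfolding JW by (rule assoc_mult_mat[OF mult_carrier_mat[OF V(1) E] P(1) PT])
    also have "\<dots> = V * E" unfolding P(3) using V E by simp
    finally show ?thesis by simp
  qed
  have GXJ: "V * G * X = J"
    unfolding X_def using GX assoc_mult_mat[OF mult_carrier_mat[OF V(1) G] P(1) cc(3)] by metis
  have B: "minv G * E = X * R"
  proof -
    have "V * (G * (X * R)) = V * G * X * R"
      using V G Xc Rc by (simp add: assoc_mult_mat[of _ n n _ n _ n] assoc_mult_mat[of _ n n _ r _ n])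
    also have "\<dots> = V * E" unfolding GXJ EJR ..
    finally have "U * (V * (G * (X * R))) = U * (V * E)" by simp
    then have "G * (X * R) = E"
      using U V G E Xc Rc by (simp add: assoc_mult_mat[of U n n V n _ n, symmetric])
    then have "minv G * E = (minv G * G) * (X * R)"
      using Gi(1) G Xc Rc by (simp add: assoc_mult_mat[of _ n n G n _ n])
    then show ?thesis unfolding Gi(3) using Xc Rc by simp
  qed
  have left: "(J\<^sup>T * (V * G)) * X = 1\<^sub>m r"
    using JJ GXJ cc V G Xc by (simp add: assoc_mult_mat[of _ r n _ n _ r])
  have "mat_rank R = mat_rank (V * E)"
    unfolding EJR by (rule mat_rank_mult_left[OF cc(1) Rc _ JJ, symmetric]) (use cc in simp)
  also have "\<dots> = r" using mat_rank_mult_left[OF V(1) E U(1) V(2)] r by simp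
  finally obtain Q where Q: "Q \<in> carrier_mat n r" "R * Q = 1\<^sub>m r"
    using full_row_rank_right_inverse[of R n] Rc by metis
  have pow_rank: "mat_rank ((X * R) ^\<^sub>m Suc k) = mat_rank ((E1 * Z) ^\<^sub>m k)"
  proof -
    have p: "(E1 * Z) ^\<^sub>m k \<in> carrier_mat r r" using E1c Z by simp
    have "(X * R) ^\<^sub>m Suc k = X * (E1 * Z) ^\<^sub>m k * R" using pow_mat_mult_swap[OF Xc Rc] RX by simp
    also have "mat_rank \<dots> = mat_rank (X * (E1 * Z) ^\<^sub>m k)"
      by (rule mat_rank_mult_right[OF Rc mult_carrier_mat[OF Xc p] Q])
    also have "\<dots> = mat_rank ((E1 * Z) ^\<^sub>m k)"
      by (rule mat_rank_mult_left[OF Xc p _ left]) (use cc V G in simp)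
    finally show ?thesis .
  qed
  \<comment> \<open>The swap produced \<open>E1 * Z\<close>, whereas the new pencil is measured by
    \<open>Z * E1\<close>; conjugation by \<open>G1\<close>, the inverse of \<open>Z\<close>,
    relates their powers. Exponent zero is separate because the swap formula starts at one.\<close>
  have conj: "mat_rank ((Z * E1) ^\<^sub>m k) = mat_rank ((E1 * Z) ^\<^sub>m k)"
  proof (cases k)
    case 0 then show ?thesis using E1c Z by simp
  next
    case (Suc j)
    have p: "(Z * E1) ^\<^sub>m k \<in> carrier_mat r r" using E1c Z by simp
    have assoc: "G1 * (Z * Q * E1) * Z = (G1 * Z) * (Q * (E1 * Z))" if "Q \<in> carrier_mat r r" for Q
      using G1c Z(1) E1c that by (simp add: assoc_mult_mat[of _ r r _ r _ r])
    have "G1 * ((Z * E1) ^\<^sub>m k) * Z = G1 * (Z * (E1 * Z) ^\<^sub>m j * E1) * Z"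
      unfolding Suc using pow_mat_mult_swap[OF Z(1) E1c] by simp
    also have "\<dots> = (G1 * Z) * ((E1 * Z) ^\<^sub>m j * (E1 * Z))"
      by (rule assoc) (use E1c Z(1) in simp)
    also have "\<dots> = (E1 * Z) ^\<^sub>m k" unfolding Suc Z(2) using E1c Z(1) by simp
    finally have "mat_rank ((E1 * Z) ^\<^sub>m k) = mat_rank (G1 * ((Z * E1) ^\<^sub>m k) * Z)" by simp
    also have "\<dots> = mat_rank (G1 * ((Z * E1) ^\<^sub>m k))"
      by (rule mat_rank_mult_right[OF Z(1) mult_carrier_mat[OF G1c p] G1c Z(3)])
    also have "\<dots> = mat_rank ((Z * E1) ^\<^sub>m k)" by (rule mat_rank_mult_left[OF G1c p Z(1,3)])
    finally show ?thesis by simp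
  qed
  show "mat_rank ((minv (l \<cdot>\<^sub>m E1 + A1) * E1) ^\<^sub>m k) = mat_rank ((minv (l \<cdot>\<^sub>m E + A) * E) ^\<^sub>m Suc k)"
    using pow_rank conj B unfolding G_def[symmetric] G1_def[symmetric] Z_def by simp
qed

section \<open>Smoothness of the inhomogeneity\<close>


text \<open>Derivatives at points of an open set are local, so altering a function outside
  \<open>I\<close> has no effect. This suits \<open>g\<close>, \<open>h\<close> and
  \<open>f1\<close>, which a step prescribes on \<open>I\<close> alone.\<close>

lemma C_diff_on_cong:
  assumes I: "open I" and eq: "\<And>t. t \<in> I \<Longrightarrow> u t = v t" and u: "C_diff_on k I u"
  shows "C_diff_on k I v"
proof (cases k)
  case 0 then show ?thesis using u eq continuous_on_cong[of I I u v] by simp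
next
  case (Suc m)
  then obtain u' where u': "\<And>t. t \<in> I \<Longrightarrow> (u has_real_derivative u' t) (at t)" "C_diff_on m I u'"
    using u by auto
  have "(v has_real_derivative u' t) (at t)" if "t \<in> I" for t
    using has_field_derivative_transform_within_open[OF u'(1)[OF that] I that] eq by blast
  then show ?thesis using Suc u'(2) by auto
qed

lemma C_diff_on_SucD: "C_diff_on (Suc k) I u \<Longrightarrow> C_diff_on k I u"
proof (induction k arbitrary: u)
  case 0 then show ?case by (auto intro!: continuous_at_imp_continuous_on intro: DERIV_isCont)
next
  case (Suc k) then show ?case by (metis C_diff_on.simps(2))
qed

lemma C_diff_on_zero: "C_diff_on k I (\<lambda>_. 0)"
  by (induction k) (auto intro!: exI[of _ "\<lambda>_. 0"])

lemma C_diff_on_add: "C_diff_on k I u \<Longrightarrow> C_diff_on k I v \<Longrightarrow> C_diff_on k I (\<lambda>t. u t + v t)"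
proof (induction k arbitrary: u v)
  case 0 then show ?case by (auto intro: continuous_on_add)
next
  case (Suc k)
  then obtain u' v' where "\<forall>t\<in>I. (u has_real_derivative u' t) (at t)" "C_diff_on k I u'"
    "\<forall>t\<in>I. (v has_real_derivative v' t) (at t)" "C_diff_on k I v'" by auto
  then show ?case using Suc.IH by (auto intro!: exI[of _ "\<lambda>t. u' t + v' t"] DERIV_add)
qed

lemma C_diff_on_cmult: "C_diff_on k I u \<Longrightarrow> C_diff_on k I (\<lambda>t. c * u t)"
proof (induction k arbitrary: u)
  case 0 then show ?case by (auto intro: continuous_on_mult_left)
next
  case (Suc k)
  then obtain u' where "\<forall>t\<in>I. (u has_real_derivative u' t) (at t)" "C_diff_on k I u'" by auto
  then show ?case using Suc.IH by (auto intro!: exI[of _ "\<lambda>t. c * u' t"] DERIV_cmult)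
qed

lemma C_diff_on_sum:
  assumes "\<And>j. j \<in> S \<Longrightarrow> C_diff_on k I (u j)"
  shows "C_diff_on k I (\<lambda>t. \<Sum>j\<in>S. u j t)"
  using assms
  by (induction S rule: infinite_finite_induct) (auto intro: C_diff_on_zero C_diff_on_add)

section \<open>Vector-valued functions and the loss of one derivative per step\<close>

lemma vec_C_diff_on_cong:
  assumes I: "open I" and eq: "\<And>t. t \<in> I \<Longrightarrow> f t = g t" and f: "vec_C_diff_on k n I f"
  shows "vec_C_diff_on k n I g"
  using f eq C_diff_on_cong[OF I, of "\<lambda>t. f t $ i" "\<lambda>t. g t $ i" k for i]
  unfolding vec_C_diff_on_def by simp

lemma vec_C_diff_on_SucD: "vec_C_diff_on (Suc k) n I f \<Longrightarrow> vec_C_diff_on k n I f"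
  unfolding vec_C_diff_on_def using C_diff_on_SucD by blast

lemma vec_C_diff_on_mult_mat_vec:
  assumes I: "open I" and M: "M \<in> carrier_mat m n" and f: "vec_C_diff_on k n I f"
  shows "vec_C_diff_on k m I (\<lambda>t. M *\<^sub>v f t)"
  unfolding vec_C_diff_on_def
proof (intro conjI ballI allI impI)
  fix i assume i: "i < m"
  have "C_diff_on k I (\<lambda>t. \<Sum>j\<in>{0..<n}. M $$ (i, j) * f t $ j)"
    using f unfolding vec_C_diff_on_def by (intro C_diff_on_sum C_diff_on_cmult) auto
  then show "C_diff_on k I (\<lambda>t. (M *\<^sub>v f t) $ i)"
    by (rule C_diff_on_cong[OF I, rotated])
      (use f M i in \<open>auto simp: vec_C_diff_on_def scalar_prod_def intro!: sum.cong\<close>)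
qed (use M f in \<open>auto simp: vec_C_diff_on_def intro: mult_mat_vec_carrier\<close>)

lemma vec_C_diff_on_add:
  assumes I: "open I" and f: "vec_C_diff_on k n I f" and g: "vec_C_diff_on k n I g"
  shows "vec_C_diff_on k n I (\<lambda>t. f t + g t)"
  unfolding vec_C_diff_on_def
proof (intro conjI ballI allI impI)
  fix i assume i: "i < n"
  have "C_diff_on k I (\<lambda>t. f t $ i + g t $ i)"
    using f g i unfolding vec_C_diff_on_def by (intro C_diff_on_add) auto
  then show "C_diff_on k I (\<lambda>t. (f t + g t) $ i)"
    by (rule C_diff_on_cong[OF I, rotated]) (use g i in \<open>auto simp: vec_C_diff_on_def\<close>)
qed (use f g in \<open>auto simp: vec_C_diff_on_def\<close>)

lemma vec_C_diff_on_appendD: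
  assumes I: "open I" and gh: "vec_C_diff_on k (r + m) I (\<lambda>t. g t @\<^sub>v h t)"
    and g: "\<And>t. t \<in> I \<Longrightarrow> g t \<in> carrier_vec r" and h: "\<And>t. t \<in> I \<Longrightarrow> h t \<in> carrier_vec m"
  shows "vec_C_diff_on k r I g" "vec_C_diff_on k m I h"
proof -
  have c: "C_diff_on k I (\<lambda>t. (g t @\<^sub>v h t) $ i)" if "i < r + m" for i
    using gh that unfolding vec_C_diff_on_def by blast
  have "C_diff_on k I (\<lambda>t. g t $ i)" if "i < r" for i
    by (rule C_diff_on_cong[OF I _ c[of i]]) (use that g h in fastforce)+
  moreover have "C_diff_on k I (\<lambda>t. h t $ i)" if "i < m" for i
    by (rule C_diff_on_cong[OF I _ c[of "r + i"]]) (use that g h in fastforce)+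
  ultimately show "vec_C_diff_on k r I g" "vec_C_diff_on k m I h"
    unfolding vec_C_diff_on_def using g h by auto
qed

text \<open>A step may name any \<open>h'\<close> that is a derivative of \<open>h\<close> on
  \<open>I\<close>; uniqueness of derivatives forces it to agree there with the one witnessing
  \<open>C_diff_on\<close>.\<close>

lemma vec_C_diff_on_deriv:
  assumes I: "open I" and h: "vec_C_diff_on (Suc k) m I h" and d: "vec_deriv_on m I h h'"
  shows "vec_C_diff_on k m I h'"
proof -
  have "C_diff_on k I (\<lambda>t. h' t $ i)" if i: "i < m" for i
  proof -
    have "C_diff_on (Suc k) I (\<lambda>t. h t $ i)" using h i unfolding vec_C_diff_on_def by blast
    then obtain u where u: "\<And>t. t \<in> I \<Longrightarrow> ((\<lambda>t. h t $ i) has_real_derivative u t) (at t)" "C_diff_on k I u"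
      by auto
    have "u t = h' t $ i" if "t \<in> I" for t
      using DERIV_unique[OF u(1)[OF that]] d i that unfolding vec_deriv_on_def by blast
    then show ?thesis by (rule C_diff_on_cong[OF I _ u(2)])
  qed
  then show ?thesis using d unfolding vec_C_diff_on_def vec_deriv_on_def by blast
qed

text \<open>The only loss is one order, through the term with \<open>h'\<close>; the other terms
  apply constant matrices to components of the transformed \<open>f\<close>. The new dimension
  \<open>mat_rank E\<close> is the size of the new pencil.\<close>

lemma deflation_step_smooth:
  assumes I: "open I" and f: "vec_C_diff_on (Suc k) (dim_row E) I f"
    and step: "deflation_step I (E, A, f) (E1, A1, f1)"
  shows "vec_C_diff_on k (mat_rank E) I f1"
proof -
  define n where "n = dim_row E"
  define r where "r = mat_rank E"
  obtain U P S T K L M N g h h' where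
    reg: "regular_pencil n E A" and
    U: "U \<in> carrier_mat n n" "invertible_mat U" and
    c: "T \<in> carrier_mat r (n - r)" "L \<in> carrier_mat r (n - r)" and
    N: "N \<in> carrier_mat (n - r) (n - r)" "invertible_mat N" and
    gh: "\<And>t. t \<in> I \<Longrightarrow> g t \<in> carrier_vec r" "\<And>t. t \<in> I \<Longrightarrow> h t \<in> carrier_vec (n - r)"
      "\<And>t. t \<in> I \<Longrightarrow> minv U *\<^sub>v f t = g t @\<^sub>v h t" and
    d: "vec_deriv_on (n - r) I h h'" and
    f1: "\<And>t. t \<in> I \<Longrightarrow> f1 t = (T * minv N) *\<^sub>v h' t - (L * minv N) *\<^sub>v h t + g t"
    using step unfolding deflation_step_def Let_def n_def[symmetric] r_def[symmetric] prod.case by blast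
  note Ni = minv(1)[OF N]
  have "r \<le> n" using reg mat_rank_le(1)[of E n n] unfolding regular_pencil_def r_def by blast
  then have n: "n = r + (n - r)" by simp
  have "vec_C_diff_on (Suc k) n I (\<lambda>t. minv U *\<^sub>v f t)"
    by (rule vec_C_diff_on_mult_mat_vec[OF I minv(1)[OF U] f[folded n_def]])
  from vec_C_diff_on_cong[OF I gh(3) this]
  have "vec_C_diff_on (Suc k) (r + (n - r)) I (\<lambda>t. g t @\<^sub>v h t)" using n by metis
  from vec_C_diff_on_appendD[OF I this gh(1,2)]
  have g: "vec_C_diff_on (Suc k) r I g" and h: "vec_C_diff_on (Suc k) (n - r) I h" by auto
  have cLN: "L * minv N \<in> carrier_mat r (n - r)" and cTN: "T * minv N \<in> carrier_mat r (n - r)" using c Ni by auto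
  \<comment> \<open>The difference is written as a sum with a negated matrix, so that the function
    is built from matrix images and sums alone.\<close>
  have "vec_C_diff_on k r I (\<lambda>t. (T * minv N) *\<^sub>v h' t + (- (L * minv N)) *\<^sub>v h t + g t)"
    by (intro vec_C_diff_on_add[OF I] vec_C_diff_on_mult_mat_vec[OF I cTN] vec_C_diff_on_SucD[OF g]
        vec_C_diff_on_mult_mat_vec[OF I uminus_carrier_mat[OF cLN]] vec_C_diff_on_deriv[OF I h d]
        vec_C_diff_on_SucD[OF h])
  moreover have "(T * minv N) *\<^sub>v h' t + (- (L * minv N)) *\<^sub>v h t + g t = f1 t" if "t \<in> I" for t
  proof -
    have "(- (L * minv N)) *\<^sub>v h t = - ((L * minv N) *\<^sub>v h t)"
      by (rule uminus_mult_mat_vec) (use cLN gh(2)[OF that] in auto)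
    then show ?thesis
      unfolding f1[OF that] using cTN cLN minus_add_uminus_vec[of "(T * minv N) *\<^sub>v h' t" r "(L * minv N) *\<^sub>v h t"]
      by (metis mult_mat_vec_carrier gh(2) that d vec_deriv_on_def)
  qed
  ultimately show ?thesis unfolding r_def[symmetric] by (rule vec_C_diff_on_cong[OF I, rotated])
qed

section \<open>Existence of deflation steps and their invariants\<close>


text \<open>Serves to move chosen columns to the last \<open>m\<close> positions; counting supplies
  an arbitrary bijection \<open>e\<close> from the first \<open>r\<close> positions to the remaining
  columns.\<close>

lemma permutation_extending:
  fixes q :: "nat \<Rightarrow> nat"
  assumes q: "inj_on q {..<m}" "q ` {..<m} \<subseteq> {..<r + m}"
  obtains \<sigma> where "\<sigma> permutes {..<r + m}" "\<And>k. k < m \<Longrightarrow> \<sigma> (r + k) = q k"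
proof -
  have "card ({..<r + m} - q ` {..<m}) = card {..<r}"
    using q by (simp add: card_Diff_subset card_image)
  then obtain e where e: "bij_betw e {..<r} ({..<r + m} - q ` {..<m})"
    using finite_same_card_bij[of "{..<r}" "{..<r + m} - q ` {..<m}"] by auto
  define \<sigma> where "\<sigma> j = (if j < r then e j else if j < r + m then q (j - r) else j)" for j
  have "bij_betw \<sigma> {..<r} ({..<r + m} - q ` {..<m})"
    using e by (rule bij_betw_cong[THEN iffD1, rotated]) (simp add: \<sigma>_def)
  moreover have "bij_betw \<sigma> {r..<r + m} (q ` {..<m})"
  proof (rule bij_betwI')
    fix x y assume xy: "x \<in> {r..<r + m}" "y \<in> {r..<r + m}"
    then have "(q (x - r) = q (y - r)) = (x - r = y - r)" by (intro inj_on_eq_iff[OF q(1)]) auto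
    then show "(\<sigma> x = \<sigma> y) = (x = y)" using xy by (auto simp: \<sigma>_def)
  next
    fix x assume "x \<in> {r..<r + m}"
    then show "\<sigma> x \<in> q ` {..<m}" by (auto simp: \<sigma>_def)
  next
    fix y assume "y \<in> q ` {..<m}"
    then obtain k where "k < m" "y = q k" by auto
    then show "\<exists>x\<in>{r..<r + m}. y = \<sigma> x" by (intro bexI[of _ "r + k"]) (auto simp: \<sigma>_def)
  qed
  ultimately have "bij_betw \<sigma> ({..<r} \<union> {r..<r + m}) (({..<r + m} - q ` {..<m}) \<union> q ` {..<m})"
    by (rule bij_betw_combine) auto
  moreover have "{..<r} \<union> {r..<r + m} = {..<r + m}" by auto
  moreover have "({..<r + m} - q ` {..<m}) \<union> q ` {..<m} = {..<r + m}" using q(2) by auto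
  ultimately have "\<sigma> permutes {..<r + m}" by (intro bij_imp_permutes) (auto simp: \<sigma>_def)
  then show thesis using that by (auto simp: \<sigma>_def)
qed

text \<open>Row reduction of \<open>E\<close> fixes the row transformation: \<open>U\<close> is
  \<open>H\<close>, whose inverse \<open>G\<close> creates the zero rows. The column order is still
  free, and it is spent on making \<open>N\<close> invertible.\<close>

lemma deflation_blocks_exist:
  assumes reg: "regular_pencil n E A"
  defines "r \<equiv> mat_rank E"
  obtains U P S T K L M N where "U \<in> carrier_mat n n" "invertible_mat U" "permutation_matrix n P"
    "S \<in> carrier_mat r r" "K \<in> carrier_mat r r" "T \<in> carrier_mat r (n - r)"
    "L \<in> carrier_mat r (n - r)" "M \<in> carrier_mat (n - r) r" "N \<in> carrier_mat (n - r) (n - r)"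
    "invertible_mat N"
    "minv U * E * P = four_block_mat S T (0\<^sub>m (n - r) r) (0\<^sub>m (n - r) (n - r))"
    "minv U * A * P = four_block_mat K L M N"
proof -
  obtain l where E: "E \<in> carrier_mat n n" and A: "A \<in> carrier_mat n n" and l: "invertible_mat (l \<cdot>\<^sub>m E + A)"
    using reg unfolding regular_pencil_def by blast
  define C where "C = l \<cdot>\<^sub>m E + A"
  have C: "C \<in> carrier_mat n n" unfolding C_def using E A by simp
  note Ci = minv[OF C l[folded C_def]]
  obtain G H where G: "G \<in> carrier_mat n n" and H: "H \<in> carrier_mat n n"
    and GH: "G * H = 1\<^sub>m n" "H * G = 1\<^sub>m n" and rn: "r \<le> n"
    and zero: "\<And>i j. r \<le> i \<Longrightarrow> i < n \<Longrightarrow> j < n \<Longrightarrow> (G * E) $$ (i, j) = 0"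
    using mat_rank_pivots[OF E] unfolding r_def by metis
  define m where "m = n - r"
  have n: "n = r + m" "n - r = m" using rn unfolding m_def by auto
  define W where "W = G * A"
  have W: "W \<in> carrier_mat n n" unfolding W_def using G A by simp
  \<comment> \<open>The last rows of \<open>G * E\<close> vanish, so those of \<open>G * A\<close> are rows of the invertible \<open>G * C\<close>;
    hence \<open>A2\<close> has full row rank, and its pivot columns supply \<open>N\<close>.\<close>
  define A2 where "A2 = mat m n (\<lambda>(i, j). W $$ (r + i, j))"
  have A2: "A2 \<in> carrier_mat m n" unfolding A2_def by simp
  define D :: "real mat" where "D = mat m n (\<lambda>(i, j). if j = r + i then 1 else 0)"
  have D: "D \<in> carrier_mat m n" unfolding D_def by simp
  have GC: "(G * C) $$ (i, j) = l * (G * E) $$ (i, j) + W $$ (i, j)" if "i < n" "j < n" for i j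
  proof -
    have "G * C = l \<cdot>\<^sub>m (G * E) + W"
      unfolding C_def W_def using G E A by (simp add: mult_add_distrib_mat[of _ n n _ n] mult_smult_distrib)
    then show ?thesis using that G E W by simp
  qed
  have A2D: "A2 = D * (G * C)"
  proof (rule eq_matI)
    fix i j assume "i < dim_row (D * (G * C))" "j < dim_col (D * (G * C))"
    then have ij: "i < m" "j < n" using D C by auto
    have "(D * (G * C)) $$ (i, j) = (\<Sum>k\<in>{0..<n}. (if k = r + i then 1 else 0) * (G * C) $$ (k, j))"
      using ij G C by (simp add: D_def scalar_prod_def)
    also have "\<dots> = (G * C) $$ (r + i, j)" using ij n by (simp add: if_distrib[of "\<lambda>x. x * _"] cong: if_cong)
    also have "\<dots> = W $$ (r + i, j)" using GC[of "r + i" j] zero[of "r + i" j] ij n by simp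
    finally show "A2 $$ (i, j) = (D * (G * C)) $$ (i, j)" using ij by (simp add: A2_def)
  qed (use A2 D C in auto)
  have DD: "D * D\<^sup>T = 1\<^sub>m m"
  proof (rule eq_matI)
    fix i j assume "i < dim_row (1\<^sub>m m :: real mat)" "j < dim_col (1\<^sub>m m :: real mat)"
    then have ij: "i < m" "j < m" by auto
    have "(D * D\<^sup>T) $$ (i, j) = (\<Sum>k\<in>{0..<n}. (if k = r + i then 1 else 0) * (if k = r + j then 1 else 0))"
      using ij by (simp add: D_def scalar_prod_def)
    also have "\<dots> = (if i = j then 1 else 0)" using ij n by (simp add: if_distrib[of "\<lambda>x. x * _"] cong: if_cong)
    finally show "(D * D\<^sup>T) $$ (i, j) = (1\<^sub>m m) $$ (i, j)" using ij by simp
  qed (use D in auto)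
  have "(G * C) * (minv C * H) = G * ((C * minv C) * H)"
    using G C Ci(1) H by (simp add: assoc_mult_mat[of _ n n _ n _ n])
  then have GCi: "(G * C) * (minv C * H) = 1\<^sub>m n" unfolding Ci(2) using H GH by simp
  have "mat_rank A2 = mat_rank D"
    unfolding A2D by (rule mat_rank_mult_right[OF mult_carrier_mat[OF G C] D mult_carrier_mat[OF Ci(1) H] GCi])
  also have "\<dots> = m"
    using mat_rank_eqI[OF one_carrier_mat D one_carrier_mat, of "D\<^sup>T"] DD D by simp
  finally have rA2: "mat_rank A2 = m" .
  obtain G2 q where G2: "G2 \<in> carrier_mat m m" and q: "\<And>k. k < m \<Longrightarrow> q k < n"
    "\<And>i k. i < m \<Longrightarrow> k < m \<Longrightarrow> (G2 * A2) $$ (i, q k) = (if i = k then 1 else 0)"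
    using mat_rank_pivots[OF A2] unfolding rA2 by metis
  have "inj_on q {..<m}"
  proof (rule inj_onI)
    fix i k assume "i \<in> {..<m}" "k \<in> {..<m}" "q i = q k"
    then show "i = k" using q(2)[of i i] q(2)[of i k] by (auto split: if_splits)
  qed
  moreover have "q ` {..<m} \<subseteq> {..<r + m}" using q(1) n by auto
  ultimately obtain \<sigma> where \<sigma>: "\<sigma> permutes {..<r + m}" "\<And>k. k < m \<Longrightarrow> \<sigma> (r + k) = q k"
    using permutation_extending by blast
  have \<sigma>n: "\<sigma> j < n" if "j < n" for j using permutes_in_image[OF \<sigma>(1), of j] that n by simp
  define P :: "real mat" where "P = mat n n (\<lambda>(i, j). if i = \<sigma> j then 1 else 0)"
  have P: "P \<in> carrier_mat n n" unfolding P_def by simp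
  have perm: "permutation_matrix n P" unfolding permutation_matrix_def P_def using \<sigma>(1) n by auto
  have BP: "(B * P) $$ (i, j) = B $$ (i, \<sigma> j)" if "B \<in> carrier_mat n n" "i < n" "j < n" for B i j
  proof -
    have "(B * P) $$ (i, j) = (\<Sum>k\<in>{0..<n}. B $$ (i, k) * (if k = \<sigma> j then 1 else 0))"
      using that by (simp add: P_def scalar_prod_def)
    also have "\<dots> = B $$ (i, \<sigma> j)"
      using \<sigma>n[OF that(3)] by (simp add: if_distrib[of "\<lambda>x. _ * x"] cong: if_cong)
    finally show ?thesis .
  qed
  define EP where "EP = G * E * P"
  define AP where "AP = G * A * P"
  define N where "N = mat m m (\<lambda>(i, j). AP $$ (r + i, r + j))"
  have N: "N \<in> carrier_mat m m" unfolding N_def by simp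
  \<comment> \<open>The permutation \<sigma> puts the pivot columns of \<open>A2\<close> last, so
    \<open>N\<close> consists of these columns and the elimination matrix \<open>G2\<close> is its
    inverse.\<close>
  have "G2 * N = 1\<^sub>m m"
  proof (rule eq_matI)
    fix i j assume "i < dim_row (1\<^sub>m m :: real mat)" "j < dim_col (1\<^sub>m m :: real mat)"
    then have ij: "i < m" "j < m" by auto
    have "N $$ (k, j) = A2 $$ (k, q j)" if "k < m" for k
      using BP[OF W, of "r + k" "r + j"] \<sigma>(2)[OF ij(2)] q(1)[OF ij(2)] that ij n
      unfolding N_def AP_def A2_def W_def by simp
    then have "(G2 * N) $$ (i, j) = (G2 * A2) $$ (i, q j)"
      using ij G2 N A2 q(1)[OF ij(2)] by (simp add: scalar_prod_def)
    then show "(G2 * N) $$ (i, j) = (1\<^sub>m m) $$ (i, j)" using q(2) ij by simp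
  qed (use G2 N in auto)
  then have invN: "invertible_mat N"
    using invertible_matI(1)[OF N G2] mat_mult_left_right_inverse[OF G2 N] by blast
  have U: "invertible_mat H" "minv H = G" using invertible_matI[OF H G GH(2)] by auto
  have EPc: "EP \<in> carrier_mat n n" and APc: "AP \<in> carrier_mat n n"
    unfolding EP_def AP_def using G E A P by auto
  show thesis
  proof (rule that[of H P "mat r r (\<lambda>(i, j). EP $$ (i, j))" "mat r r (\<lambda>(i, j). AP $$ (i, j))"
        "mat r m (\<lambda>(i, j). EP $$ (i, r + j))" "mat r m (\<lambda>(i, j). AP $$ (i, r + j))"
        "mat m r (\<lambda>(i, j). AP $$ (r + i, j))" N, unfolded n(2), OF H U(1) perm _ _ _ _ _ N invN])
    have "EP $$ (i, j) = 0" if "r \<le> i" "i < n" "j < n" for i j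
      using BP[of "G * E" i j] zero[of i "\<sigma> j"] that \<sigma>n G E unfolding EP_def by simp
    then show "minv H * E * P = four_block_mat (mat r r (\<lambda>(i, j). EP $$ (i, j)))
        (mat r m (\<lambda>(i, j). EP $$ (i, r + j))) (0\<^sub>m m r) (0\<^sub>m m m)"
      unfolding U(2) EP_def[symmetric] using EPc n by (intro eq_matI) auto
    show "minv H * A * P = four_block_mat (mat r r (\<lambda>(i, j). AP $$ (i, j)))
        (mat r m (\<lambda>(i, j). AP $$ (i, r + j))) (mat m r (\<lambda>(i, j). AP $$ (r + i, j))) N"
      unfolding U(2) AP_def[symmetric] N_def using APc n by (intro eq_matI) auto
  qed auto
qed

text \<open>The blocks come from \<open>E\<close> and \<open>A\<close> alone; the smoothness of
  \<open>f\<close> supplies the derivative of \<open>h\<close>, and \<open>Suc k\<close> guarantees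
  at least one order.\<close>

lemma deflation_step_exists:
  assumes reg: "regular_pencil n E A" and I: "open I" and f: "vec_C_diff_on (Suc k) n I f"
  shows "\<exists>D. deflation_step I (E, A, f) D"
proof -
  define r where "r = mat_rank E"
  have E: "E \<in> carrier_mat n n" using reg unfolding regular_pencil_def by blast
  have n: "r \<le> n" "dim_row E = n" using mat_rank_le(1)[OF E] E unfolding r_def by auto
  obtain U P S T K L M N where b: "U \<in> carrier_mat n n" "invertible_mat U" "permutation_matrix n P"
    "S \<in> carrier_mat r r" "K \<in> carrier_mat r r" "T \<in> carrier_mat r (n - r)"
    "L \<in> carrier_mat r (n - r)" "M \<in> carrier_mat (n - r) r" "N \<in> carrier_mat (n - r) (n - r)"
    "invertible_mat N"
    "minv U * E * P = four_block_mat S T (0\<^sub>m (n - r) r) (0\<^sub>m (n - r) (n - r))"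
    "minv U * A * P = four_block_mat K L M N"
    by (rule deflation_blocks_exist[OF reg, folded r_def])
  define V where "V = minv U"
  have V: "V \<in> carrier_mat n n" unfolding V_def by (rule minv[OF b(1,2)])
  define g where "g t = vec_first (V *\<^sub>v f t) r" for t
  define h where "h t = vec_last (V *\<^sub>v f t) (n - r)" for t
  have g: "g t \<in> carrier_vec r" and h: "h t \<in> carrier_vec (n - r)" for t
    unfolding g_def h_def by auto
  have Vf: "V *\<^sub>v f t = g t @\<^sub>v h t" if "t \<in> I" for t
  proof -
    have "V *\<^sub>v f t \<in> carrier_vec (r + (n - r))"
      using V f that n(1) unfolding vec_C_diff_on_def by simp
    then show ?thesis unfolding g_def h_def by simp
  qed
  have "vec_C_diff_on (Suc k) n I (\<lambda>t. V *\<^sub>v f t)" by (rule vec_C_diff_on_mult_mat_vec[OF I V f])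
  from vec_C_diff_on_cong[OF I Vf this]
  have "vec_C_diff_on (Suc k) (r + (n - r)) I (\<lambda>t. g t @\<^sub>v h t)" using n(1) by simp
  note hC = vec_C_diff_on_appendD(2)[OF I this g h]
  have "\<exists>u. \<forall>t\<in>I. ((\<lambda>t. h t $ i) has_real_derivative u t) (at t)" if "i < n - r" for i
  proof -
    have "C_diff_on (Suc k) I (\<lambda>t. h t $ i)" using hC that unfolding vec_C_diff_on_def by blast
    then show ?thesis unfolding C_diff_on.simps by (elim exE conjE) (rule exI)
  qed
  then obtain u where u: "\<And>i t. i < n - r \<Longrightarrow> t \<in> I \<Longrightarrow> ((\<lambda>t. h t $ i) has_real_derivative u i t) (at t)"
    by metis
  define h' where "h' t = vec (n - r) (\<lambda>i. u i t)" for t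
  have "vec_deriv_on (n - r) I h h'"
    unfolding vec_deriv_on_def h'_def using u h by auto
  note h' = this
  have "deflation_step I (E, A, f) (S - T * minv N * M, K - L * minv N * M,
      \<lambda>t. (T * minv N) *\<^sub>v h' t - (L * minv N) *\<^sub>v h t + g t)"
    unfolding deflation_step_def Let_def prod.case n(2) r_def[symmetric]
    by (rule conjI[OF reg], rule exI[of _ U], rule exI[of _ P], rule exI[of _ S], rule exI[of _ T],
        rule exI[of _ K], rule exI[of _ L], rule exI[of _ M], rule exI[of _ N], rule exI[of _ g],
        rule exI[of _ h], rule exI[of _ h'])
      (simp add: b g h h' Vf[unfolded V_def])
  then show ?thesis by blast
qed

section \<open>Rank invariants of a step and of a run\<close>

lemma deflation_step_invariants:
  assumes step: "deflation_step I D D'"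
    and E: "E_of D \<in> carrier_mat n n" and reg: "invertible_mat (l \<cdot>\<^sub>m E_of D + A_of D)"
  shows "E_of D' \<in> carrier_mat (mat_rank (E_of D)) (mat_rank (E_of D))"
    "A_of D' \<in> carrier_mat (mat_rank (E_of D)) (mat_rank (E_of D))"
    "invertible_mat (l \<cdot>\<^sub>m E_of D' + A_of D')"
    "mat_rank (A_of D) + mat_rank (E_of D) = mat_rank (A_of D') + n"
    "mat_rank ((minv (l \<cdot>\<^sub>m E_of D' + A_of D') * E_of D') ^\<^sub>m k) =
      mat_rank ((minv (l \<cdot>\<^sub>m E_of D + A_of D) * E_of D) ^\<^sub>m Suc k)"
proof -
  obtain E A f where D: "D = (E, A, f)" by (cases D) auto
  obtain E1 A1 f1 where D': "D' = (E1, A1, f1)" by (cases D') auto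
  define r where "r = mat_rank E"
  have n: "dim_row E = n" and E: "E \<in> carrier_mat n n" using E unfolding D E_of_def by auto
  have of: "E_of D = E" "A_of D = A" "E_of D' = E1" "A_of D' = A1"
    unfolding D D' E_of_def A_of_def by simp_all
  obtain U P S T K L M N where A: "regular_pencil n E A" and b: "U \<in> carrier_mat n n" "invertible_mat U"
    "permutation_matrix n P"
    "S \<in> carrier_mat r r" "K \<in> carrier_mat r r" "T \<in> carrier_mat r (n - r)"
    "L \<in> carrier_mat r (n - r)" "M \<in> carrier_mat (n - r) r" "N \<in> carrier_mat (n - r) (n - r)"
    "invertible_mat N"
    "minv U * E * P = four_block_mat S T (0\<^sub>m (n - r) r) (0\<^sub>m (n - r) (n - r))"
    "minv U * A * P = four_block_mat K L M N"
    "E1 = S - T * minv N * M" "A1 = K - L * minv N * M"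
    using step unfolding D D' deflation_step_def Let_def prod.case n r_def[symmetric] by blast
  have "A \<in> carrier_mat n n" using A unfolding regular_pencil_def by blast
  note alg = deflation_algebra[OF E this r_def[symmetric] reg[unfolded of] b]
  have "r \<le> n" using mat_rank_le(1)[OF E] unfolding r_def .
  \<comment> \<open>The drop by \<open>n - r\<close> is rewritten additively, which keeps truncated
    subtraction out of the induction over a run.\<close>
  then show "mat_rank (A_of D) + mat_rank (E_of D) = mat_rank (A_of D') + n"
    using alg(4) unfolding of r_def[symmetric] by simp
  show "E_of D' \<in> carrier_mat (mat_rank (E_of D)) (mat_rank (E_of D))"
    "A_of D' \<in> carrier_mat (mat_rank (E_of D)) (mat_rank (E_of D))"
    "invertible_mat (l \<cdot>\<^sub>m E_of D' + A_of D')"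
    "mat_rank ((minv (l \<cdot>\<^sub>m E_of D' + A_of D') * E_of D') ^\<^sub>m k) =
      mat_rank ((minv (l \<cdot>\<^sub>m E_of D + A_of D) * E_of D) ^\<^sub>m Suc k)"
    using alg(1-3,5) unfolding of r_def[symmetric] by auto
qed

lemma deflation_run_invariants:
  assumes run: "deflation_run I (E, A, f) k s" and jk: "j \<le> k"
    and E: "E \<in> carrier_mat n n" and A: "A \<in> carrier_mat n n" and reg: "invertible_mat (l \<cdot>\<^sub>m E + A)"
  defines "B \<equiv> minv (l \<cdot>\<^sub>m E + A) * E"
  shows "E_of (s j) \<in> carrier_mat (mat_rank (B ^\<^sub>m j)) (mat_rank (B ^\<^sub>m j))"
    "A_of (s j) \<in> carrier_mat (mat_rank (B ^\<^sub>m j)) (mat_rank (B ^\<^sub>m j))"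
    "invertible_mat (l \<cdot>\<^sub>m E_of (s j) + A_of (s j))"
    "mat_rank (E_of (s j)) = mat_rank (B ^\<^sub>m Suc j)"
    "mat_rank (A_of (s j)) + n = mat_rank A + mat_rank (B ^\<^sub>m j)"
proof -
  let ?B = "\<lambda>D. minv (l \<cdot>\<^sub>m E_of D + A_of D) * E_of D"
  \<comment> \<open>The factor \<open>minv (...)\<close> is invertible, so the first power already
    shows the rank of \<open>E_of D\<close>.\<close>
  have rank: "mat_rank (?B D ^\<^sub>m 1) = mat_rank (E_of D)"
    if "E_of D \<in> carrier_mat m m" "A_of D \<in> carrier_mat m m" "invertible_mat (l \<cdot>\<^sub>m E_of D + A_of D)" for D m
  proof -
    have G: "l \<cdot>\<^sub>m E_of D + A_of D \<in> carrier_mat m m" using that by simp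
    note Gi = minv[OF G that(3)]
    have "?B D \<in> carrier_mat m m" using Gi(1) that(1) by simp
    then show ?thesis using mat_rank_mult_left[OF Gi(1) that(1) G Gi(2)] by simp
  qed
  have Bc: "B \<in> carrier_mat n n" unfolding B_def using minv(1)[OF _ reg, of n] E A by simp
  \<comment> \<open>The induction carries all exponents \<open>i\<close>, since a step shifts them
    by one. The case \<open>i = 1\<close> is the rank of the current E, which is the size of the
    next pencil.\<close>
  have "E_of (s j) \<in> carrier_mat (mat_rank (B ^\<^sub>m j)) (mat_rank (B ^\<^sub>m j)) \<and>
    A_of (s j) \<in> carrier_mat (mat_rank (B ^\<^sub>m j)) (mat_rank (B ^\<^sub>m j)) \<and>
    invertible_mat (l \<cdot>\<^sub>m E_of (s j) + A_of (s j)) \<and>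
    mat_rank (A_of (s j)) + n = mat_rank A + mat_rank (B ^\<^sub>m j) \<and>
    (\<forall>i. mat_rank (?B (s j) ^\<^sub>m i) = mat_rank (B ^\<^sub>m (j + i)))"
    using jk
  proof (induction j)
    case 0
    have s: "E_of (s 0) = E" "A_of (s 0) = A"
      using run unfolding deflation_run_def E_of_def A_of_def by auto
    have "mat_rank (B ^\<^sub>m 0) = n" using Bc invertible_iff_mat_rank[of "1\<^sub>m n" n]
        invertible_matI(1)[of "1\<^sub>m n" n "1\<^sub>m n"] by simp
    then show ?case unfolding s B_def[symmetric] using E A reg by simp
  next
    case (Suc j)
    define m where "m = mat_rank (B ^\<^sub>m j)"
    have IH: "E_of (s j) \<in> carrier_mat m m" "A_of (s j) \<in> carrier_mat m m"
      "invertible_mat (l \<cdot>\<^sub>m E_of (s j) + A_of (s j))"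
      "mat_rank (A_of (s j)) + n = mat_rank A + m"
      "\<And>i. mat_rank (?B (s j) ^\<^sub>m i) = mat_rank (B ^\<^sub>m (j + i))"
      using Suc unfolding m_def by auto
    have "deflation_step I (s j) (s (Suc j))" using run Suc.prems unfolding deflation_run_def by simp
    note inv = deflation_step_invariants[OF this IH(1,3)]
    have "mat_rank (E_of (s j)) = mat_rank (B ^\<^sub>m Suc j)"
      using rank[OF IH(1-3)] IH(5)[of 1] by simp
    then show ?case using inv(1-4) IH(4) IH(5)[of "Suc i" for i] inv(5) by auto
  qed
  then have 1: "E_of (s j) \<in> carrier_mat (mat_rank (B ^\<^sub>m j)) (mat_rank (B ^\<^sub>m j))"
    "A_of (s j) \<in> carrier_mat (mat_rank (B ^\<^sub>m j)) (mat_rank (B ^\<^sub>m j))"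
    "invertible_mat (l \<cdot>\<^sub>m E_of (s j) + A_of (s j))"
    "mat_rank (A_of (s j)) + n = mat_rank A + mat_rank (B ^\<^sub>m j)"
    and 2: "mat_rank (?B (s j) ^\<^sub>m 1) = mat_rank (B ^\<^sub>m (j + 1))" by blast+
  show "E_of (s j) \<in> carrier_mat (mat_rank (B ^\<^sub>m j)) (mat_rank (B ^\<^sub>m j))"
    "A_of (s j) \<in> carrier_mat (mat_rank (B ^\<^sub>m j)) (mat_rank (B ^\<^sub>m j))"
    "invertible_mat (l \<cdot>\<^sub>m E_of (s j) + A_of (s j))"
    "mat_rank (A_of (s j)) + n = mat_rank A + mat_rank (B ^\<^sub>m j)"
    by (fact 1)+
  show "mat_rank (E_of (s j)) = mat_rank (B ^\<^sub>m Suc j)" using rank[OF 1(1-3)] 2 by simp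
qed

section \<open>Stopping and the bound on the number of steps\<close>

lemma continues_iff:
  assumes "E_of D \<in> carrier_mat n n"
  shows "continues D \<longleftrightarrow> mat_rank (E_of D) \<noteq> n \<and> mat_rank (E_of D) \<noteq> 0"
proof -
  obtain E A f where D: "D = (E, A, f)" by (cases D)
  have "dim_row E = n" "dim_col E = n" using assms unfolding D E_of_def by auto
  then show ?thesis
    using invertible_iff_mat_rank[OF assms] mat_rank_eq_0_iff[OF assms]
    unfolding D E_of_def continues.simps fst_conv by metis
qed

text \<open>The strict bound concerns states that must still continue; a run of several steps
  inherits the non-strict one from its last continuing state. Every continuing state makes two
  consecutive ranks of powers differ and keeps the later one positive.\<close>

lemma deflation_run_continues_bound:
  assumes reg: "regular_pencil n E A" and run: "deflation_run I (E, A, f) k s" and cont: "continues (s k)"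
  shows "k < min (mat_rank E) (kronecker_index E A)"
proof -
  \<comment> \<open>This is the choice made in \<open>kronecker_index\<close>, so that
    \<open>B\<close> is the very matrix whose index is taken.\<close>
  define l where "l = (SOME l. invertible_mat (l \<cdot>\<^sub>m E + A))"
  have E: "E \<in> carrier_mat n n" and A: "A \<in> carrier_mat n n" and l: "invertible_mat (l \<cdot>\<^sub>m E + A)"
    using reg someI_ex[of "\<lambda>l. invertible_mat (l \<cdot>\<^sub>m E + A)"] unfolding regular_pencil_def l_def by auto
  define B where "B = minv (l \<cdot>\<^sub>m E + A) * E"
  have G: "l \<cdot>\<^sub>m E + A \<in> carrier_mat n n" using E A by simp
  have B: "B \<in> carrier_mat n n" unfolding B_def using minv(1)[OF G l] E by simp
  note inv = deflation_run_invariants[OF run _ E A l, folded B_def]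
  have c: "continues (s j)" if "j \<le> k" for j
    using that run cont unfolding deflation_run_def by (cases "j = k") auto
  have neq: "mat_rank (B ^\<^sub>m Suc j) \<noteq> mat_rank (B ^\<^sub>m j)" "mat_rank (B ^\<^sub>m Suc j) \<noteq> 0" if "j \<le> k" for j
    using c[OF that] continues_iff[OF inv(1)[OF that]] inv(4)[OF that] by auto
  \<comment> \<open>The rank drops after each of the exponents 0 to k, which are k + 1 in number;
    hence the strict inequality for the index.\<close>
  have "Suc k \<le> mat_index B" by (rule mat_index_geI[OF B neq(1)]) simp
  moreover have "kronecker_index E A = mat_index B"
    unfolding kronecker_index_def Let_def l_def B_def ..
  \<comment> \<open>Each exponent from 1 to j costs at least one unit of rank, starting from rank B
    = rank E. At j = k the remaining rank is still positive.\<close>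
  moreover have "mat_rank (B ^\<^sub>m Suc j) + j \<le> mat_rank E" if "j \<le> k" for j
    using that
  proof (induction j)
    case 0
    have "s 0 = (E, A, f)" using run unfolding deflation_run_def by simp
    then show ?case using inv(4)[of 0] by (simp add: E_of_def)
  next
    case (Suc j)
    have "mat_rank (B ^\<^sub>m Suc (Suc j)) \<le> mat_rank (B ^\<^sub>m Suc j)"
      using mat_rank_le(1)[OF inv(1)[OF Suc.prems]] inv(4)[OF Suc.prems] by simp
    then show ?case using neq(1)[OF Suc.prems] Suc by linarith
  qed
  from this[of k] have "k < mat_rank E" using neq(2)[of k] by linarith
  ultimately show ?thesis by simp
qed

text \<open>Because a step is a relation that requires a derivative, stopping has two sides: no
  execution is infinite, and none gets stuck while it should continue. Independence of the choices
  is expressed by a second execution that may even use another interval and another inhomogeneity;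
  equal stopping times make the two rank sequences equally long.\<close>

theorem theorem3:
  fixes E A :: "real mat" and f :: "real \<Rightarrow> real vec" and I :: "real set" and n :: nat
  assumes "regular_pencil n E A"
    and "open I" and "connected I"
    and "vec_C_diff_on (min (mat_rank E) (kronecker_index E A)) n I f"
  shows "\<not> (\<exists>s. \<forall>k. deflation_run I (E, A, f) k s) \<and>
    (\<forall>k s. deflation_run I (E, A, f) k s \<and> continues (s k) \<longrightarrow>
       (\<exists>D. deflation_step I (s k) D)) \<and>
    (\<forall>k s. deflation_run I (E, A, f) k s \<longrightarrow>
       k \<le> min (mat_rank E) (kronecker_index E A)) \<and>
    (\<forall>k s J \<phi> l u. deflation_run I (E, A, f) k s \<and> deflation_run J (E, A, \<phi>) l u \<longrightarrow>
       (\<forall>j\<le>min k l. mat_rank (E_of (s j)) = mat_rank (E_of (u j)) \<and>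
                    mat_rank (A_of (s j)) = mat_rank (A_of (u j))) \<and>
       (\<not> continues (s k) \<and> \<not> continues (u l) \<longrightarrow> k = l))"
proof -
  define b where "b = min (mat_rank E) (kronecker_index E A)"
  obtain a where E: "E \<in> carrier_mat n n" and A: "A \<in> carrier_mat n n" and l: "invertible_mat (a \<cdot>\<^sub>m E + A)"
    using assms(1) unfolding regular_pencil_def by blast
  define B where "B = minv (a \<cdot>\<^sub>m E + A) * E"
  note inv = deflation_run_invariants[OF _ _ E A l, folded B_def]
  have bound: "k \<le> b" if run: "deflation_run I (E, A, f) k s" for k s
  proof (cases k)
    \<comment> \<open>The state before the last step was a continuing one, so the strict bound for
      \<open>j\<close> gives the plain bound for \<open>Suc j\<close>.\<close>
    case (Suc j)
    then have "deflation_run I (E, A, f) j s" "continues (s j)"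
      using run unfolding deflation_run_def by auto
    then show ?thesis using deflation_run_continues_bound[OF assms(1)] Suc unfolding b_def by fastforce
  qed simp
  \<comment> \<open>An infinite execution would include one with \<open>b + 1\<close> steps.\<close>
  then have nonterm: "\<not> (\<exists>s. \<forall>k. deflation_run I (E, A, f) k s)"
    by (metis not_less_eq_eq order_refl)
  have progress: "\<exists>D. deflation_step I (s k) D"
    if run: "deflation_run I (E, A, f) k s" and cont: "continues (s k)" for k s
  proof -
    note inv = inv[OF run]
    \<comment> \<open>The derivative budget: after \<open>j\<close> steps \<open>b - j\<close>
      orders remain. The subtraction is genuine because j \<le> k \<le> b.\<close>
    have smooth: "vec_C_diff_on (b - j) (mat_rank (B ^\<^sub>m j)) I (snd (snd (s j)))" if "j \<le> k" for j
      using that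
    proof (induction j)
      case 0
      have "s 0 = (E, A, f)" using run unfolding deflation_run_def by simp
      moreover have "mat_rank (B ^\<^sub>m 0) = n" using inv(1)[of 0] E calculation
        by (metis E_of_def fst_conv carrier_matD(1) le0)
      ultimately show ?case using assms(4) unfolding b_def by simp
    next
      case (Suc j)
      have step: "deflation_step I (s j) (s (Suc j))" using run Suc.prems unfolding deflation_run_def by simp
      have "b - j = Suc (b - Suc j)" using bound[OF run] Suc.prems by simp
      moreover have "dim_row (E_of (s j)) = mat_rank (B ^\<^sub>m j)" using inv(1)[of j] Suc.prems by auto
      ultimately have "vec_C_diff_on (Suc (b - Suc j)) (dim_row (E_of (s j))) I (snd (snd (s j)))"
        using Suc by simp
      then have "vec_C_diff_on (b - Suc j) (mat_rank (E_of (s j))) I (snd (snd (s (Suc j))))"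
        using deflation_step_smooth[OF assms(2), of _ "E_of (s j)" "snd (snd (s j))" "A_of (s j)"] step
        unfolding E_of_def A_of_def by (metis prod.collapse)
      then show ?case using inv(4)[of j] Suc.prems by simp
    qed
    \<comment> \<open>Strictness leaves at least one order for the step to be performed.\<close>
    have "k < b" using deflation_run_continues_bound[OF assms(1) run cont] unfolding b_def .
    then have "vec_C_diff_on (Suc (b - Suc k)) (mat_rank (B ^\<^sub>m k)) I (snd (snd (s k)))"
      using smooth[of k] by (simp add: Suc_diff_Suc)
    moreover have "regular_pencil (mat_rank (B ^\<^sub>m k)) (E_of (s k)) (A_of (s k))"
      using inv(1-3)[OF order_refl] unfolding regular_pencil_def by blast
    ultimately show ?thesis
      using deflation_step_exists[OF _ assms(2)] unfolding E_of_def A_of_def by (metis prod.collapse)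
  qed
  \<comment> \<open>By \<open>continues_iff\<close> the decision to continue depends on ranks alone,
    so it agrees in both executions at every common index.\<close>
  have ranks: "mat_rank (E_of (s j)) = mat_rank (E_of (u j)) \<and> mat_rank (A_of (s j)) = mat_rank (A_of (u j))
      \<and> (continues (s j) \<longleftrightarrow> continues (u j))"
    if "deflation_run I (E, A, f) k s" "deflation_run J (E, A, \<phi>) l u" "j \<le> k" "j \<le> l" for k s J \<phi> l u j
    using inv(4,5)[OF that(1,3)] inv(4,5)[OF that(2,4)]
      continues_iff[OF inv(1)[OF that(1,3)]] continues_iff[OF inv(1)[OF that(2,4)]] by auto
  have stop: "k = l"
    if "deflation_run I (E, A, f) k s" "deflation_run J (E, A, \<phi>) l u" "\<not> continues (s k)" "\<not> continues (u l)"
    for k s J \<phi> l u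
  \<comment> \<open>If the lengths differed, the longer execution would continue at the index at
    which the shorter one has stopped.\<close>
  proof (rule ccontr)
    assume "k \<noteq> l"
    then consider "k < l" | "l < k" by linarith
    then show False
    proof cases
      case 1
      then have "continues (u k)" using that(2) unfolding deflation_run_def by simp
      then show False using ranks[OF that(1,2), of k] that(3) 1 by simp
    next
      case 2
      then have "continues (s l)" using that(1) unfolding deflation_run_def by simp
      then show False using ranks[OF that(1,2), of l] that(4) 2 by simp
    qed
  qed
  show ?thesis
    unfolding b_def[symmetric] min.bounded_iff
    by (intro conjI allI impI nonterm; (elim conjE)?) (rule progress bound stop ranks[THEN conjunct1]
        ranks[THEN conjunct2, THEN conjunct1]; assumption)+
qed

end
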